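(* Assume (H1)–(H4) and (U) (for given $x_0\in\mathbb{R}^n$, $r>0$, $\theta>0$). Let $u\in C(\mathbb{R}^n\times[0,T))$ be a viscosity solution of (1.1)–(1.2). Then for any $t_0\in(0,T]$ satisfying $$\theta^2 e^{-((\frac{\beta}{2}+2)C_1+2K_3)t_0}-2C_1\beta t_0>0,$$ we have $$|p|\ \ge\ \sqrt{\theta^2 e^{-((\frac{\beta}{2}+2)C_1+2K_3)t}-2C_1\beta t}$$ for all $(x,t)\in\mathcal{E}(x_0,r)\cap(\mathbb{R}^n\times(0,t_0))$ and all $p\in D_x^-u(x,t)$.
   Context: Let $T>0$, $n\ge1$. $H:\mathbb{R}^n\times[0,T]\times\mathbb{R}\times\mathbb{R}^n\to\mathbb{R}$ is continuous and $u_0:\mathbb{R}^n\to\mathbb{R}$ is Lipschitz continuous. Problem (1.1)–(1.2): $u_t+H(x,t,u,D_xu)=0$ in $\mathbb{R}^n\times(0,T)$, $u(x,0)=u_0(x)$ on $\mathbb{R}^n$. Hypotheses: (H1) there exist $C_1\ge0$, $\beta\in\{0,1\}$ with $|H(x,t,u,p)-H(y,t,u,p)|\le C_1(\beta+|p|)|x-y|$ for all $t,u,p,x,y$. (H2) there exist $A_2,B_2\ge0$ with $|H(x,t,u,p)-H(x,t,u,q)|\le(A_2|x|+B_2)|p-q|$ for all $x,t,u,p,q$. (H3) there exists $K_3\ge0$ with $|H(x,t,u,p)-H(x,t,v,p)|\le K_3|u-v|$ for all $x,t,p,u,v$. (H4) $p\mapsto H(x,t,u,p)$ is convex for all $(x,t,u)$.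 (U) for the given $x_0\in\mathbb{R}^n$, $r>0$ there is $\theta>0$ with $|p|\ge\theta$ for all $x\in B_r(x_0)$ and $p\in D^-u_0(x)$. Viscosity solution: $u\in C(\mathbb{R}^n\times[0,T))$ with $u(\cdot,0)=u_0$, such that for every $\phi\in C^1(\mathbb{R}^n\times(0,T))$, if $u-\phi$ has a local maximum (resp. minimum) at $(x,t)\in\mathbb{R}^n\times(0,T)$ then $\phi_t(x,t)+H(x,t,u(x,t),D_x\phi(x,t))\le0$ (resp. $\ge0$). Subdifferential: for $f$ on $\mathbb{R}^m$, $D^-f(x)=\{D\phi(x):\phi\in C^1,\ f-\phi\text{ has a local minimum at }x\}$; for $u(x,t)$, $D_x^-u(x,t)=\{p:(p,\tau)\in D^-u(x,t)\text{ for some }\tau\}$. $B_r(x)$ is the open Euclidean ball. $R(x,t)=(\frac{B_2}{A_2}+|x|)(e^{A_2t}-1)$ if $A_2>0$, $R(x,t)=B_2t$ if $A_2=0$; $\mathcal{E}(x_0,r)=\{(x,t)\in B_r(x_0)\times(0,T): R(x,t)+|x-x_0|<r\}$. *)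

theory Defs
  imports "HOL-Analysis.Analysis"
begin

definition C1_xt :: "('a::euclidean_space \<times> real) set \<Rightarrow> ('a \<times> real \<Rightarrow> real)
    \<Rightarrow> ('a \<times> real \<Rightarrow> 'a) \<Rightarrow> ('a \<times> real \<Rightarrow> real) \<Rightarrow> bool" where
  "C1_xt S \<phi> Dx Dt \<longleftrightarrow> continuous_on S Dx \<and> continuous_on S Dt \<and>
     (\<forall>z\<in>S. (\<phi> has_derivative (\<lambda>(h, s). Dx z \<bullet> h + Dt z * s)) (at z))"

definition C1_x :: "('a::euclidean_space) set \<Rightarrow> ('a \<Rightarrow> real) \<Rightarrow> ('a \<Rightarrow> 'a) \<Rightarrow> bool" where
  "C1_x S \<psi> G \<longleftrightarrow> continuous_on S G \<and> (\<forall>z\<in>S. (\<psi> has_derivative (\<lambda>h. G z \<bullet> h)) (at z))"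

definition subdiff :: "('a::euclidean_space \<Rightarrow> real) \<Rightarrow> 'a \<Rightarrow> 'a set" where
  "subdiff f x = {G x | \<psi> G. C1_x UNIV \<psi> G \<and>
       (\<forall>\<^sub>F y in nhds x. f y - \<psi> y \<ge> f x - \<psi> x)}"

definition subdiff_xt :: "('a::euclidean_space \<Rightarrow> real \<Rightarrow> real) \<Rightarrow> 'a \<Rightarrow> real \<Rightarrow> ('a \<times> real) set" where
  "subdiff_xt u x t = {(Dx (x, t), Dt (x, t)) | \<phi> Dx Dt. C1_xt UNIV \<phi> Dx Dt \<and>
       (\<forall>\<^sub>F (y, s) in nhds (x, t). u y s - \<phi> (y, s) \<ge> u x t - \<phi> (x, t))}"

definition subdiff_x :: "('a::euclidean_space \<Rightarrow> real \<Rightarrow> real) \<Rightarrow> 'a \<Rightarrow> real \<Rightarrow> 'a set" where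
  "subdiff_x u x t = {p. \<exists>\<tau>. (p, \<tau>) \<in> subdiff_xt u x t}"

definition viscosity_solution ::
  "('a::euclidean_space \<Rightarrow> real \<Rightarrow> real \<Rightarrow> 'a \<Rightarrow> real) \<Rightarrow> ('a \<Rightarrow> real) \<Rightarrow> real
     \<Rightarrow> ('a \<Rightarrow> real \<Rightarrow> real) \<Rightarrow> bool" where
  "viscosity_solution H u0 T u \<longleftrightarrow>
     continuous_on (UNIV \<times> {0..<T}) (\<lambda>(x, t). u x t) \<and>
     (\<forall>x. u x 0 = u0 x) \<and>
     (\<forall>\<phi> Dx Dt x t. C1_xt (UNIV \<times> {0<..<T}) \<phi> Dx Dt \<and> t \<in> {0<..<T} \<longrightarrow>
        ((\<forall>\<^sub>F (y, s) in nhds (x, t). u y s - \<phi> (y, s) \<le> u x t - \<phi> (x, t)) \<longrightarrow>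
            Dt (x, t) + H x t (u x t) (Dx (x, t)) \<le> 0) \<and>
        ((\<forall>\<^sub>F (y, s) in nhds (x, t). u y s - \<phi> (y, s) \<ge> u x t - \<phi> (x, t)) \<longrightarrow>
            Dt (x, t) + H x t (u x t) (Dx (x, t)) \<ge> 0))"

definition Rfun :: "real \<Rightarrow> real \<Rightarrow> 'a::euclidean_space \<Rightarrow> real \<Rightarrow> real" where
  "Rfun A2 B2 x t = (if A2 > 0 then (B2 / A2 + norm x) * (exp (A2 * t) - 1) else B2 * t)"

definition Eset :: "real \<Rightarrow> real \<Rightarrow> real \<Rightarrow> 'a::euclidean_space \<Rightarrow> real \<Rightarrow> ('a \<times> real) set" where
  "Eset A2 B2 T x0 r = {(x, t). x \<in> ball x0 r \<and> t \<in> {0<..<T} \<and> Rfun A2 B2 x t + dist x x0 < r}"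

end

theory Submission
  imports Defs
begin

text \<open>For a solution \<open>u\<close>, let \<open>w x t\<close> be the minimum over \<open>y\<close> of \<open>u y t + exp (- \<mu> * t) * |x - y|^2 / (2 * \<epsilon>)\<close>
  with \<open>\<mu> = K3 + 2 * C1 + C1 * \<beta> / 2\<close>. Hypothesis (U) says that \<open>u0\<close> drops by at least \<open>\<theta> * h\<close>
  within distance \<open>h\<close> of each point, so \<open>w \<le> u - \<epsilon> * \<theta>^2 / 2\<close> at time 0. Convexity of \<open>H\<close> makes
  \<open>w\<close> a subsolution up to the error \<open>C1 * \<beta> * \<epsilon> * exp (\<mu> * t)\<close>: along the characteristic directions
  of affine minorants of \<open>H\<close>, \<open>u\<close> satisfies a dynamic programming inequality, which unlike the
  subsolution property itself survives taking minima. Comparing \<open>w\<close> with the supersolution \<open>u\<close> on the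
  cone of dependence preserves a gap of order \<open>\<epsilon>\<close>, and letting \<open>\<epsilon>\<close> tend to 0 turns the gap at
  \<open>(x, t)\<close> into the lower bound for the elements of the subdifferential.\<close>

subsection \<open>Differentiable test functions and subgradients\<close>

text \<open>The obstacle is that a minimum of subsolutions need not be a subsolution, while
  comparing \<open>w\<close> with \<open>u\<close> needs exactly that for the minimum defining
  \<open>w\<close>; convexity of \<open>H\<close> is what removes it. The rate in the theorem is
  \<mu> + \<open>K3\<close>. The part \<mu> comes from the decaying weight, which pays for
  evaluating \<open>H\<close> at the minimizer \<open>y\<close> instead of at \<open>x\<close>. The
  second \<open>K3\<close> comes from the comparison of \<open>w\<close> with \<open>u\<close>,
  where (H3) acts on the gap itself, so that the gap decays at rate \<open>K3\<close> even when
  \<open>C1 = 0\<close>. The term linear in \<open>t\<close> is the accumulated error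
  \<open>C1 * \<beta> * \<epsilon> * exp (\<mu> * t)\<close>. Two facts force the localisation. The
  propagation speed allowed by (H2) may grow with |x|, and \<open>u\<close> is assumed only
  continuous. So every maximum is taken over a ball with a barrier confining it to a backward cone,
  and a local Lipschitz bound in space is derived from that of \<open>u0\<close> beforehand; it
  controls how far minimizers move and which slopes the penalties can have.\<close>

lemma C1_xt_subset: "C1_xt S \<phi> A B \<Longrightarrow> R \<subseteq> S \<Longrightarrow> C1_xt R \<phi> A B"
  unfolding C1_xt_def by (auto intro: continuous_on_subset)

lemma C1_xt_add:
  assumes "C1_xt S \<phi> A B" "C1_xt S \<psi> C D"
  shows "C1_xt S (\<lambda>z. \<phi> z + \<psi> z) (\<lambda>z. A z + C z) (\<lambda>z. B z + D z)"
  using assms unfolding C1_xt_def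
  by (auto intro!: continuous_intros)
    (drule (1) bspec, drule (1) bspec, rule has_derivative_eq_rhs[OF has_derivative_add],
      auto simp: algebra_simps inner_add_left)

lemma C1_xt_imp_continuous_on: "C1_xt S \<phi> A B \<Longrightarrow> continuous_on S \<phi>"
  unfolding C1_xt_def
  by (auto intro!: continuous_at_imp_continuous_on dest!: bspec has_derivative_continuous)

lemma C1_xt_mult:
  assumes "C1_xt S \<phi> A B" "C1_xt S \<psi> C D"
  shows "C1_xt S (\<lambda>z. \<phi> z * \<psi> z) (\<lambda>z. \<phi> z *\<^sub>R C z + \<psi> z *\<^sub>R A z) (\<lambda>z. \<phi> z * D z + \<psi> z * B z)"
  using C1_xt_imp_continuous_on[OF assms(1)] C1_xt_imp_continuous_on[OF assms(2)] assms
  unfolding C1_xt_def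
  by (auto intro!: continuous_intros)
    (drule (1) bspec, drule (1) bspec, rule has_derivative_eq_rhs[OF has_derivative_mult],
      auto simp: algebra_simps inner_add_left)

lemma C1_xt_compose:
  assumes "C1_xt S \<phi> A B" and k: "\<And>v. (k has_real_derivative k' v) (at v)" "continuous_on UNIV k'"
  shows "C1_xt S (\<lambda>z. k (\<phi> z)) (\<lambda>z. k' (\<phi> z) *\<^sub>R A z) (\<lambda>z. k' (\<phi> z) * B z)"
proof -
  have c: "continuous_on S (\<lambda>z. k' (\<phi> z))"
    by (rule continuous_on_compose2[OF k(2) C1_xt_imp_continuous_on[OF assms(1)]]) auto
  have "((\<lambda>z. k (\<phi> z)) has_derivative (\<lambda>(h, s). (k' (\<phi> z) *\<^sub>R A z) \<bullet> h + k' (\<phi> z) * B z * s)) (at z)"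
    if "z \<in> S" for z
  proof -
    have "(\<phi> has_derivative (\<lambda>(h, s). A z \<bullet> h + B z * s)) (at z)"
      using assms(1) that unfolding C1_xt_def by auto
    from has_derivative_compose[OF this k(1)[of "\<phi> z", unfolded has_field_derivative_def]]
    show ?thesis
      by (simp add: case_prod_unfold distrib_left mult.assoc)
  qed
  then show ?thesis
    using assms(1) c unfolding C1_xt_def by (auto intro!: continuous_intros)
qed

lemma C1_xt_time:
  assumes "\<And>t. (h has_real_derivative h' t) (at t)" "continuous_on UNIV h'"
  shows "C1_xt UNIV (\<lambda>z. h (snd z)) (\<lambda>z. 0) (\<lambda>z. h' (snd z))"
proof -
  have "C1_xt UNIV (snd :: 'a \<times> real \<Rightarrow> real) (\<lambda>z. 0) (\<lambda>z. 1)"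
    unfolding C1_xt_def by (auto simp: case_prod_beta intro!: derivative_eq_intros)
  from C1_xt_compose[OF this, of h h'] assms show ?thesis by simp
qed

text \<open>The centre moves with velocity \<open>q\<close>. With \<open>q = 0\<close> this is the
  ordinary quadratic penalty; with \<open>q\<close> a characteristic direction the penalty follows a
  characteristic of the equation.\<close>

lemma C1_xt_norm_square:
  "C1_xt UNIV (\<lambda>z. (norm (fst z - c - snd z *\<^sub>R q))\<^sup>2) (\<lambda>z. 2 *\<^sub>R (fst z - c - snd z *\<^sub>R q))
     (\<lambda>z. - 2 * ((fst z - c - snd z *\<^sub>R q) \<bullet> q))"
proof -
  have "((\<lambda>z. (norm (fst z - c - snd z *\<^sub>R q))\<^sup>2) has_derivative (\<lambda>(h, s).
      (2 *\<^sub>R (fst z - c - snd z *\<^sub>R q)) \<bullet> h + - 2 * ((fst z - c - snd z *\<^sub>R q) \<bullet> q) * s)) (at z)"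
    for z :: "'a \<times> real"
  proof -
    have "((\<lambda>z. fst z - c - snd z *\<^sub>R q) has_derivative (\<lambda>z'. fst z' - 0 - snd z' *\<^sub>R q)) (at z)"
      by (intro derivative_intros)
    from has_derivative_inner[OF this this] show ?thesis
      unfolding power2_norm_eq_inner
    proof (rule has_derivative_eq_rhs)
      let ?d = "fst z - c - snd z *\<^sub>R q"
      have "d \<bullet> (h - 0 - s *\<^sub>R q) + (h - 0 - s *\<^sub>R q) \<bullet> d = (2 *\<^sub>R d) \<bullet> h + - 2 * (d \<bullet> q) * s" for d h s
        by (simp add: inner_diff_right inner_diff_left inner_commute)
      then show "(\<lambda>h. ?d \<bullet> (fst h - 0 - snd h *\<^sub>R q) + (fst h - 0 - snd h *\<^sub>R q) \<bullet> ?d)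
          = (\<lambda>(h, s). (2 *\<^sub>R ?d) \<bullet> h + - 2 * (?d \<bullet> q) * s)"
        by (simp add: case_prod_unfold)
    qed
  qed
  then show ?thesis
    unfolding C1_xt_def by (intro conjI ballI continuous_intros)
qed

lemma C1_xt_weighted_norm_square:
  assumes "\<And>t. (\<kappa> has_real_derivative \<kappa>' t) (at t)" "continuous_on UNIV \<kappa>'"
  shows "C1_xt UNIV (\<lambda>z. \<kappa> (snd z) * (norm (fst z - c))\<^sup>2) (\<lambda>z. (2 * \<kappa> (snd z)) *\<^sub>R (fst z - c))
     (\<lambda>z. \<kappa>' (snd z) * (norm (fst z - c))\<^sup>2)"
  using C1_xt_mult[OF C1_xt_time[OF assms] C1_xt_norm_square[of c 0]]
  by (simp add: mult.commute)

text \<open>Squaring removes the kink of the positive part, which yields a C^1 function that is zero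
  on a half-line and grows beyond it. Both the cone barrier and the late-time penalty along
  characteristics are built from it.\<close>

lemma max0_square_has_derivative: "((\<lambda>v. (max 0 v)\<^sup>2) has_real_derivative 2 * max 0 v) (at (v::real))"
proof -
  consider "v > 0" | "v < 0" | "v = 0" by linarith
  then show ?thesis
  proof cases
    case 1
    have "((\<lambda>v. v\<^sup>2) has_real_derivative 2 * max 0 v) (at v)"
      using 1 by (intro derivative_eq_intros) auto
    then show ?thesis
      by (rule has_field_derivative_transform_within[where d=v]) (use 1 in \<open>auto simp: dist_real_def\<close>)
  next
    case 2
    have "((\<lambda>v. 0) has_real_derivative 2 * max 0 v) (at v)"
      using 2 by simp
    then show ?thesis
      by (rule has_field_derivative_transform_within[where d="-v"])
        (use 2 in \<open>auto simp: dist_real_def\<close>)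
  next
    case 3
    have "((\<lambda>h. (max 0 h)\<^sup>2 / h) \<longlongrightarrow> 0) (at (0::real))"
    proof (rule Lim_null_comparison)
      show "\<forall>\<^sub>F h in at (0::real). norm ((max 0 h)\<^sup>2 / h) \<le> \<bar>h\<bar>"
        by (intro always_eventually allI) (simp add: max_def power2_eq_square)
      show "((\<lambda>h. \<bar>h\<bar>) \<longlongrightarrow> 0) (at (0::real))"
        by (rule tendsto_rabs_zero) simp
    qed
    then show ?thesis using 3 by (simp add: has_field_derivative_iff)
  qed
qed

text \<open>A hyperplane with normal \<open>(b, c)\<close> separates the strict epigraph, translated
  so that the point over \<open>p\<close> becomes 0, from 0. It cannot be vertical, since
  \<open>c = 0\<close> would give \<open>b \<bullet> (- b) \<ge> 0\<close> and hence a zero normal.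
  The subgradient is therefore \<open>- b / c\<close>.\<close>

lemma convex_on_subgradient:
  fixes f :: "'a::euclidean_space \<Rightarrow> real"
  assumes "convex_on UNIV f"
  obtains q where "\<And>p'. f p' \<ge> f p + q \<bullet> (p' - p)"
proof -
  let ?S = "{z. f (p + fst z) - f p < snd z}"
  have "convex ?S"
  proof (rule convexI)
    fix x y :: "'a \<times> real" and c d :: real
    assume xy: "x \<in> ?S" "y \<in> ?S" and cd: "0 \<le> c" "0 \<le> d" "c + d = 1"
    have "p + fst (c *\<^sub>R x + d *\<^sub>R y) = c *\<^sub>R (p + fst x) + d *\<^sub>R (p + fst y)"
    proof -
      have d: "d = 1 - c" using cd(3) by simp
      show ?thesis unfolding d by (simp add: algebra_simps)
    qed
    then have "f (p + fst (c *\<^sub>R x + d *\<^sub>R y)) \<le> c * f (p + fst x) + d * f (p + fst y)"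
      using assms cd unfolding convex_on_def by auto
    moreover have "c * (f (p + fst x) - f p) + d * (f (p + fst y) - f p) < c * snd x + d * snd y"
    proof (cases "c = 0")
      case True
      then show ?thesis using xy cd by auto
    next
      case False
      then have "c * (f (p + fst x) - f p) < c * snd x" using xy cd by auto
      moreover have "d * (f (p + fst y) - f p) \<le> d * snd y"
        using xy cd by (intro mult_left_mono) auto
      ultimately show ?thesis by linarith
    qed
    moreover have "c * (f (p + fst x) - f p) + d * (f (p + fst y) - f p)
        = c * f (p + fst x) + d * f (p + fst y) - f p"
    proof -
      have d: "d = 1 - c" using cd(3) by simp
      show ?thesis unfolding d by (simp add: algebra_simps)
    qed
    ultimately show "c *\<^sub>R x + d *\<^sub>R y \<in> ?S" by auto
  qed
  moreover have "0 \<notin> ?S" by simp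
  ultimately obtain a where a: "a \<noteq> 0" "\<forall>x\<in>?S. 0 \<le> a \<bullet> x"
    using separating_hyperplane_set_0 by blast
  obtain b c where bc: "a = (b, c)" by force
  have ineq: "0 \<le> b \<bullet> h + c * v" if "f (p + h) - f p < v" for h v
    using a(2)[rule_format, of "(h, v)"] that bc by auto
  have "c \<ge> 0" using ineq[of 0 1] by auto
  moreover have "c \<noteq> 0"
  proof
    assume "c = 0"
    then have "0 \<le> b \<bullet> (- b)" using ineq[of "- b" "f (p - b) - f p + 1"] by simp
    then have "b = 0" by (metis inner_eq_zero_iff inner_ge_zero inner_minus_right neg_0_le_iff_le order_antisym)
    then show False using \<open>c = 0\<close> a bc by (simp add: zero_prod_def)
  qed
  ultimately have c: "c > 0" by simp
  have "f p' \<ge> f p + (- (1 / c) *\<^sub>R b) \<bullet> (p' - p)" for p'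
  proof (rule field_le_epsilon)
    fix e :: real assume "e > 0"
    then have "0 \<le> b \<bullet> (p' - p) + c * (f p' - f p + e)"
      using ineq[of "p' - p" "f p' - f p + e"] by simp
    then show "f p + (- (1 / c) *\<^sub>R b) \<bullet> (p' - p) \<le> f p' + e"
      using c by (simp add: field_simps)
  qed
  then show thesis using that by blast
qed

subsection \<open>Contact points of sub- and supersolutions\<close>

text \<open>The conditions are pointwise and the Hamiltonian is a parameter because the
  inf-convolution solves a perturbed equation, and only in the interior of a ball. Test functions
  are taken on the whole space, since all those constructed below are global.\<close>

definition visc_sub_at where
  "visc_sub_at F f x t \<longleftrightarrow> (\<forall>\<phi> Dx Dt. C1_xt UNIV \<phi> Dx Dt \<longrightarrow>
     (\<forall>\<^sub>F (y, s) in nhds (x, t). f y s - \<phi> (y, s) \<le> f x t - \<phi> (x, t)) \<longrightarrow>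
     Dt (x, t) + F x t (f x t) (Dx (x, t)) \<le> 0)"

definition visc_super_at where
  "visc_super_at F f x t \<longleftrightarrow> (\<forall>\<phi> Dx Dt. C1_xt UNIV \<phi> Dx Dt \<longrightarrow>
     (\<forall>\<^sub>F (y, s) in nhds (x, t). f y s - \<phi> (y, s) \<ge> f x t - \<phi> (x, t)) \<longrightarrow>
     Dt (x, t) + F x t (f x t) (Dx (x, t)) \<ge> 0)"

lemma visc_sub_atD:
  assumes "visc_sub_at F f x t" "C1_xt UNIV \<phi> Dx Dt" "open S" "(x, t) \<in> S"
    and "\<And>y s. (y, s) \<in> S \<Longrightarrow> f y s - \<phi> (y, s) \<le> f x t - \<phi> (x, t)"
  shows "Dt (x, t) + F x t (f x t) (Dx (x, t)) \<le> 0"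
proof -
  have "\<forall>\<^sub>F (y, s) in nhds (x, t). f y s - \<phi> (y, s) \<le> f x t - \<phi> (x, t)"
    unfolding eventually_nhds using assms by (intro exI[of _ S]) auto
  then show ?thesis using assms(1,2) unfolding visc_sub_at_def by blast
qed

lemma visc_super_atD:
  assumes "visc_super_at F f x t" "C1_xt UNIV \<phi> Dx Dt" "open S" "(x, t) \<in> S"
    and "\<And>y s. (y, s) \<in> S \<Longrightarrow> f y s - \<phi> (y, s) \<ge> f x t - \<phi> (x, t)"
  shows "Dt (x, t) + F x t (f x t) (Dx (x, t)) \<ge> 0"
proof -
  have "\<forall>\<^sub>F (y, s) in nhds (x, t). f y s - \<phi> (y, s) \<ge> f x t - \<phi> (x, t)"
    unfolding eventually_nhds using assms by (intro exI[of _ S]) auto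
  then show ?thesis using assms(1,2) unfolding visc_super_at_def by blast
qed

lemma viscosity_solution_imp_sub_super:
  assumes "viscosity_solution H u0 T u" "0 < t" "t < T"
  shows "visc_sub_at H u x t" "visc_super_at H u x t"
proof -
  have C: "C1_xt UNIV \<phi> A B \<Longrightarrow> C1_xt (UNIV \<times> {0<..<T}) \<phi> A B" for \<phi> :: "'a \<times> real \<Rightarrow> real" and A B
    by (rule C1_xt_subset) auto
  have t: "t \<in> {0<..<T}" using assms by simp
  show "visc_sub_at H u x t" unfolding visc_sub_at_def
    using assms(1) C t unfolding viscosity_solution_def by blast
  show "visc_super_at H u x t" unfolding visc_super_at_def
    using assms(1) C t unfolding viscosity_solution_def by blast
qed

context
  fixes f g :: "'a::euclidean_space \<Rightarrow> real \<Rightarrow> real" and F G :: "'a \<Rightarrow> real \<Rightarrow> real \<Rightarrow> 'a \<Rightarrow> real"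
    and a :: 'a and R \<tau> :: real
  assumes cf: "continuous_on (cball a R \<times> {0..\<tau>}) (\<lambda>(x, t). f x t)"
    and cg: "continuous_on (cball a R \<times> {0..\<tau>}) (\<lambda>(x, t). g x t)"
    and cF: "continuous_on (UNIV \<times> {0..\<tau>} \<times> UNIV \<times> UNIV) (\<lambda>(x, t, v, p). F x t v p)"
    and cG: "continuous_on (UNIV \<times> {0..\<tau>} \<times> UNIV \<times> UNIV) (\<lambda>(x, t, v, p). G x t v p)"
    and sub: "\<And>x t. x \<in> ball a R \<Longrightarrow> 0 < t \<Longrightarrow> t < \<tau> \<Longrightarrow> visc_sub_at F f x t"
    and super: "\<And>x t. x \<in> ball a R \<Longrightarrow> 0 < t \<Longrightarrow> t < \<tau> \<Longrightarrow> visc_super_at G g x t"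
begin

text \<open>Doubling the time variable as well and letting its penalty blow up reduces the test at a
  contact point of \<open>f x t - g y t\<close> to one test of \<open>f\<close> in \<open>(x, t)\<close> and one of \<open>g\<close> in \<open>(y, s)\<close>.\<close>

lemma viscosity_contact_inequality:
  assumes Q: "C1_xt UNIV Q DQ Qt"
    and \<kappa>: "\<And>t. (\<kappa> has_real_derivative \<kappa>' t) (at t)" "continuous_on UNIV \<kappa>'"
    and le: "\<And>x y t. x \<in> cball a R \<Longrightarrow> y \<in> cball a R \<Longrightarrow> t \<in> {0..\<tau>} \<Longrightarrow>
        f x t - g y t \<le> Q (x, t) + \<kappa> t * (norm (x - y))\<^sup>2"
    and int: "\<And>x y t. x \<in> cball a R \<Longrightarrow> y \<in> cball a R \<Longrightarrow> t \<in> {0..\<tau>} \<Longrightarrow>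
        f x t - g y t = Q (x, t) + \<kappa> t * (norm (x - y))\<^sup>2 \<Longrightarrow>
        x \<in> ball a R \<and> y \<in> ball a R \<and> 0 < t \<and> t < \<tau>"
    and ex: "x1 \<in> cball a R" "y1 \<in> cball a R" "t1 \<in> {0..\<tau>}"
        "f x1 t1 - g y1 t1 = Q (x1, t1) + \<kappa> t1 * (norm (x1 - y1))\<^sup>2"
  obtains x y t where "x \<in> ball a R" "y \<in> ball a R" "0 < t" "t < \<tau>"
    "f x t - g y t = Q (x, t) + \<kappa> t * (norm (x - y))\<^sup>2"
    "Qt (x, t) + \<kappa>' t * (norm (x - y))\<^sup>2 + F x t (f x t) (DQ (x, t) + (2 * \<kappa> t) *\<^sub>R (x - y))
       - G y t (g y t) ((2 * \<kappa> t) *\<^sub>R (x - y)) \<le> 0"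
proof -
  define C where "C = cball a R \<times> cball a R \<times> {0..\<tau>} \<times> {0..\<tau>}"
  define J where "J n z = (case z of (x, y, t, s) \<Rightarrow>
      f x t - g y s - Q (x, t) - \<kappa> t * (norm (x - y))\<^sup>2 - n * (t - s)\<^sup>2)" for n :: real and z
  have c\<kappa>: "continuous_on UNIV \<kappa>"
    using \<kappa>(1) by (meson DERIV_continuous_on has_field_derivative_at_within)
  have cQ: "continuous_on UNIV Q" using C1_xt_imp_continuous_on[OF Q] .
  have cDQ: "continuous_on UNIV DQ" "continuous_on UNIV Qt" using Q unfolding C1_xt_def by auto
  have compC: "compact C" unfolding C_def by (intro compact_Times compact_cball compact_Icc)
  have cJ: "continuous_on C (J n)" for n
    unfolding C_def J_def case_prod_unfold
    by (intro continuous_intros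
        continuous_on_compose2[OF cf[unfolded case_prod_unfold], of _ "\<lambda>z. (fst z, fst (snd (snd z)))", simplified]
        continuous_on_compose2[OF cg[unfolded case_prod_unfold], of _ "\<lambda>z. (fst (snd z), snd (snd (snd z)))", simplified]
        continuous_on_compose2[OF c\<kappa>] continuous_on_compose2[OF cQ]) auto
  have C1: "(x1, y1, t1, t1) \<in> C" using ex unfolding C_def by auto
  then have "\<forall>n. \<exists>z. z \<in> C \<and> (\<forall>w\<in>C. J (real n) w \<le> J (real n) z)"
    using continuous_attains_sup[OF compC _ cJ] by blast
  then obtain z where "\<forall>n. z n \<in> C \<and> (\<forall>w\<in>C. J (real n) w \<le> J (real n) (z n))"
    by (rule choice[THEN exE])
  then have z: "\<And>n::nat. z n \<in> C" "\<And>n w. w \<in> C \<Longrightarrow> J (real n) w \<le> J (real n) (z n)"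
    by auto
  obtain l r where l: "l \<in> C" "strict_mono r" "(z \<circ> r) \<longlonglongrightarrow> l"
    using compC z(1) unfolding compact_def by meson
  obtain X Y t s where l_eq: "l = (X, Y, t, s)" by (cases l) auto
  define x' where "x' n = fst (z (r n))" for n
  define y' where "y' n = fst (snd (z (r n)))" for n
  define t' where "t' n = fst (snd (snd (z (r n))))" for n
  define s' where "s' n = snd (snd (snd (z (r n))))" for n
  have zr: "z (r n) = (x' n, y' n, t' n, s' n)" for n
    unfolding x'_def y'_def t'_def s'_def by simp
  have zl: "(\<lambda>n. z (r n)) \<longlonglongrightarrow> l" using l(3) by (simp add: o_def)
  have lim: "x' \<longlonglongrightarrow> X" "y' \<longlonglongrightarrow> Y" "t' \<longlonglongrightarrow> t" "s' \<longlonglongrightarrow> s"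
    using tendsto_fst[OF zl] tendsto_fst[OF tendsto_snd[OF zl]]
      tendsto_fst[OF tendsto_snd[OF tendsto_snd[OF zl]]]
      tendsto_snd[OF tendsto_snd[OF tendsto_snd[OF zl]]]
    unfolding l_eq x'_def y'_def t'_def s'_def by auto
  have inC: "x' n \<in> cball a R" "y' n \<in> cball a R" "t' n \<in> {0..\<tau>}" "s' n \<in> {0..\<tau>}" for n
    using z(1)[of "r n"] unfolding zr C_def by auto
  have lC: "X \<in> cball a R" "Y \<in> cball a R" "t \<in> {0..\<tau>}" "s \<in> {0..\<tau>}"
    using l(1) unfolding l_eq C_def by auto
  have Jpos: "J (real n) (z n) \<ge> 0" for n
    using z(2)[OF C1, of n] ex(4) unfolding J_def by auto
  have "bounded (J 0 ` C)"
    using compact_continuous_image[OF cJ compC] compact_imp_bounded by blast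
  then obtain M where M: "\<And>w. w \<in> C \<Longrightarrow> \<bar>J 0 w\<bar> \<le> M"
    unfolding bounded_iff by auto
  have J0: "J 0 (z (r n)) = J (real (r n)) (z (r n)) + real (r n) * (t' n - s' n)\<^sup>2" for n
    unfolding zr J_def by simp
  have J0pos: "J 0 (z (r n)) \<ge> 0" for n
    unfolding J0 using Jpos[of "r n"] by simp
  have "(\<lambda>n. J 0 (z (r n))) \<longlonglongrightarrow> J 0 l"
    using continuous_on_tendsto_compose[OF cJ zl l(1)] z(1) by auto
  then have J0l: "J 0 l \<ge> 0"
    using J0pos by (meson LIMSEQ_le_const)
  \<comment> \<open>Maximality against the diagonal point \<open>(x1, y1, t1, t1)\<close> keeps
    \<open>J\<close> nonnegative, so the time penalty is at most the bound of \<open>J 0\<close>;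
    passing from \<open>r n\<close> down to \<open>n\<close> uses that a strictly increasing
    \<open>r\<close> satisfies \<open>n \<le> r n\<close>.\<close>
  have pen: "real n * (t' n - s' n)\<^sup>2 \<le> M" for n
  proof -
    have "real n * (t' n - s' n)\<^sup>2 \<le> real (r n) * (t' n - s' n)\<^sup>2"
      using seq_suble[OF l(2), of n] by (intro mult_right_mono) auto
    also have "\<dots> \<le> M" using J0[of n] Jpos[of "r n"] M[OF z(1)[of "r n"]] by linarith
    finally show ?thesis .
  qed
  have "(\<lambda>n. (t' n - s' n)\<^sup>2) \<longlonglongrightarrow> 0"
  proof (rule tendsto_sandwich[of "\<lambda>_. 0" _ _ "\<lambda>n. M / real n"])
    show "\<forall>\<^sub>F n in sequentially. (t' n - s' n)\<^sup>2 \<le> M / real n"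
      using eventually_gt_at_top[of 0] by eventually_elim (use pen in \<open>simp add: field_simps\<close>)
  qed (auto intro: lim_const_over_n)
  moreover have "(\<lambda>n. (t' n - s' n)\<^sup>2) \<longlonglongrightarrow> (t - s)\<^sup>2"
    by (intro tendsto_intros lim)
  ultimately have "(t - s)\<^sup>2 = 0" using LIMSEQ_unique by blast
  then have st: "s = t" by simp
  \<comment> \<open>On the diagonal \<open>s = t\<close> the hypothesis \<open>le\<close> gives one
    inequality, and the limit of the nonnegative values of \<open>J 0\<close> gives the
    other.\<close>
  have eq: "f X t - g Y t = Q (X, t) + \<kappa> t * (norm (X - Y))\<^sup>2"
    using J0l le[OF lC(1-3)] unfolding l_eq J_def st by auto
  note I = int[OF lC(1-3) eq]
  have ev: "\<forall>\<^sub>F n in sequentially. x' n \<in> ball a R \<and> y' n \<in> ball a R \<and> t' n \<in> {0<..<\<tau>} \<and> s' n \<in> {0<..<\<tau>}"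
    using lim I st by (intro eventually_conj topological_tendstoD) auto
  let ?e = "\<lambda>x y t t2 s. Qt (x, t) + \<kappa>' t * (norm (x - y))\<^sup>2
      + F x t (f x t) (DQ (x, t) + (2 * \<kappa> t) *\<^sub>R (x - y)) - G y s (g y s) ((2 * \<kappa> t2) *\<^sub>R (x - y))"
  have ev2: "\<forall>\<^sub>F n in sequentially. ?e (x' n) (y' n) (t' n) (t' n) (s' n) \<le> 0"
    using ev
  proof eventually_elim
    case (elim n)
    let ?N = "real (r n)"
    let ?S = "ball a R \<times> {0<..<\<tau>}"
    have maxn: "w \<in> C \<Longrightarrow> J ?N w \<le> J ?N (x' n, y' n, t' n, s' n)" for w
      using z(2)[of w "r n"] zr[of n] by simp
    have d1: "((\<lambda>t. ?N * (t - s' n)\<^sup>2) has_real_derivative 2 * ?N * (t - s' n)) (at t)" for t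
      by (auto intro!: derivative_eq_intros)
    have d2: "((\<lambda>s. - ?N * (t' n - s)\<^sup>2) has_real_derivative 2 * ?N * (t' n - s)) (at s)" for s
      by (auto intro!: derivative_eq_intros simp: algebra_simps)
    note T1 = C1_xt_add[OF C1_xt_add[OF Q C1_xt_weighted_norm_square[OF \<kappa>, of "y' n"]]
        C1_xt_time[OF d1]]
    have A: "Qt (x' n, t' n) + \<kappa>' (t' n) * (norm (x' n - y' n))\<^sup>2 + 2 * ?N * (t' n - s' n)
        + F (x' n) (t' n) (f (x' n) (t' n)) (DQ (x' n, t' n) + (2 * \<kappa> (t' n)) *\<^sub>R (x' n - y' n)) \<le> 0"
    proof -
      have "f y s - (Q (y, s) + \<kappa> s * (norm (y - y' n))\<^sup>2 + ?N * (s - s' n)\<^sup>2)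
          \<le> f (x' n) (t' n) - (Q (x' n, t' n) + \<kappa> (t' n) * (norm (x' n - y' n))\<^sup>2 + ?N * (t' n - s' n)\<^sup>2)"
        if "(y, s) \<in> ?S" for y s
        using maxn[of "(y, y' n, s, s' n)"] that inC[of n] unfolding C_def J_def by auto
      then show ?thesis
        using visc_sub_atD[OF sub T1, of "x' n" "t' n" ?S] elim
        by (auto simp: open_Times continuous_intros algebra_simps)
    qed
    \<comment> \<open>The weight is evaluated at the time of \<open>f\<close>, so it is constant in
      the test for \<open>g\<close>, and \<kappa>' enters only through the test for
      \<open>f\<close>.\<close>
    have k2: "((\<lambda>t. - \<kappa> (t' n)) has_real_derivative 0) (at t)" for t by simp
    note T2 = C1_xt_add[OF C1_xt_weighted_norm_square[OF k2, of "x' n"] C1_xt_time[OF d2]]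
    have B: "2 * ?N * (t' n - s' n)
        + G (y' n) (s' n) (g (y' n) (s' n)) ((2 * \<kappa> (t' n)) *\<^sub>R (x' n - y' n)) \<ge> 0"
    proof -
      have "g y s - (- \<kappa> (t' n) * (norm (y - x' n))\<^sup>2 + - ?N * (t' n - s)\<^sup>2)
          \<ge> g (y' n) (s' n) - (- \<kappa> (t' n) * (norm (y' n - x' n))\<^sup>2 + - ?N * (t' n - s' n)\<^sup>2)"
        if "(y, s) \<in> ?S" for y s
        using maxn[of "(x' n, y, t' n, s)"] that inC[of n] unfolding C_def J_def
        by (auto simp: norm_minus_commute)
      then show ?thesis
        using visc_super_atD[OF super T2, of "y' n" "s' n" ?S] elim
        by (auto simp: open_Times continuous_intros algebra_simps)
    qed
    \<comment> \<open>Both tests contain the same unbounded term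
      \<open>2 * ?N * (t' n - s' n)\<close>; it cancels in the difference, and what remains passes
      to the limit by continuity.\<close>
    show ?case using A B by linarith
  qed
  have lim_f: "(\<lambda>n. f (x' n) (t' n)) \<longlonglongrightarrow> f X t"
    using continuous_on_tendsto_compose[OF cf tendsto_Pair[OF lim(1,3)]] lC inC by simp
  have lim_g: "(\<lambda>n. g (y' n) (s' n)) \<longlonglongrightarrow> g Y t"
    using continuous_on_tendsto_compose[OF cg tendsto_Pair[OF lim(2,4)]] lC inC st by simp
  have lim_\<kappa>: "(\<lambda>n. \<kappa> (t' n)) \<longlonglongrightarrow> \<kappa> t" "(\<lambda>n. \<kappa>' (t' n)) \<longlonglongrightarrow> \<kappa>' t"
    using continuous_on_tendsto_compose[OF c\<kappa> lim(3)] continuous_on_tendsto_compose[OF \<kappa>(2) lim(3)]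
    by auto
  have lim_Q: "(\<lambda>n. DQ (x' n, t' n)) \<longlonglongrightarrow> DQ (X, t)" "(\<lambda>n. Qt (x' n, t' n)) \<longlonglongrightarrow> Qt (X, t)"
    using continuous_on_tendsto_compose[OF cDQ(1) tendsto_Pair[OF lim(1,3)]]
      continuous_on_tendsto_compose[OF cDQ(2) tendsto_Pair[OF lim(1,3)]] by auto
  have lim_F: "(\<lambda>n. F (x' n) (t' n) (f (x' n) (t' n)) (DQ (x' n, t' n) + (2 * \<kappa> (t' n)) *\<^sub>R (x' n - y' n)))
      \<longlonglongrightarrow> F X t (f X t) (DQ (X, t) + (2 * \<kappa> t) *\<^sub>R (X - Y))"
    using continuous_on_tendsto_compose[OF cF, of "\<lambda>n. (x' n, t' n, f (x' n) (t' n),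
        DQ (x' n, t' n) + (2 * \<kappa> (t' n)) *\<^sub>R (x' n - y' n))"
        "(X, t, f X t, DQ (X, t) + (2 * \<kappa> t) *\<^sub>R (X - Y))"] inC(3) lC(3)
    by (simp add: tendsto_intros lim lim_f lim_\<kappa> lim_Q)
  have lim_G: "(\<lambda>n. G (y' n) (s' n) (g (y' n) (s' n)) ((2 * \<kappa> (t' n)) *\<^sub>R (x' n - y' n)))
      \<longlonglongrightarrow> G Y t (g Y t) ((2 * \<kappa> t) *\<^sub>R (X - Y))"
    using continuous_on_tendsto_compose[OF cG, of "\<lambda>n. (y' n, s' n, g (y' n) (s' n),
        (2 * \<kappa> (t' n)) *\<^sub>R (x' n - y' n))"
        "(Y, t, g Y t, (2 * \<kappa> t) *\<^sub>R (X - Y))"] inC(4) lC(3) lim(4)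
    by (simp add: tendsto_intros lim lim_g lim_\<kappa> st)
  have "(\<lambda>n. ?e (x' n) (y' n) (t' n) (t' n) (s' n)) \<longlonglongrightarrow> ?e X Y t t t"
    by (intro tendsto_intros lim lim_F lim_G lim_\<kappa> lim_Q)
  then have "?e X Y t t t \<le> 0"
    by (rule tendsto_upperbound[OF _ ev2]) simp
  then show thesis using that I eq by blast
qed

text \<open>The contact point is produced at the level \<open>m * exp (K * t)\<close>, with \<open>m\<close> the maximum of
  \<open>exp (- K * t) * (f x t - g y t - Q (x, t) - \<dots>)\<close>, so that \<open>f - g\<close> is known exactly there and no
  monotonicity of \<open>F\<close> in \<open>u\<close> is required.\<close>

lemma viscosity_contact_exponential:
  assumes Q: "C1_xt UNIV Q DQ Qt"
    and \<kappa>: "\<And>t. (\<kappa> has_real_derivative \<kappa>' t) (at t)" "continuous_on UNIV \<kappa>'"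
    and int: "\<And>m x y t. m \<ge> m0 \<Longrightarrow> x \<in> cball a R \<Longrightarrow> y \<in> cball a R \<Longrightarrow> t \<in> {0..\<tau>} \<Longrightarrow>
        f x t - g y t = Q (x, t) + \<kappa> t * (norm (x - y))\<^sup>2 + m * exp (K * t) \<Longrightarrow>
        f x t - g x t \<le> Q (x, t) + m * exp (K * t) \<Longrightarrow>
        x \<in> ball a R \<and> y \<in> ball a R \<and> 0 < t \<and> t < \<tau>"
    and ex: "x1 \<in> cball a R" "y1 \<in> cball a R" "t1 \<in> {0..\<tau>}"
        "f x1 t1 - g y1 t1 \<ge> Q (x1, t1) + \<kappa> t1 * (norm (x1 - y1))\<^sup>2 + m0 * exp (K * t1)"
  obtains m x y t where "m \<ge> m0" "x \<in> ball a R" "y \<in> ball a R" "0 < t" "t < \<tau>"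
    "f x t - g y t = Q (x, t) + \<kappa> t * (norm (x - y))\<^sup>2 + m * exp (K * t)"
    "f x t - g x t \<le> Q (x, t) + m * exp (K * t)"
    "Qt (x, t) + K * m * exp (K * t) + \<kappa>' t * (norm (x - y))\<^sup>2
       + F x t (f x t) (DQ (x, t) + (2 * \<kappa> t) *\<^sub>R (x - y)) - G y t (g y t) ((2 * \<kappa> t) *\<^sub>R (x - y)) \<le> 0"
proof -
  define C where "C = cball a R \<times> cball a R \<times> {0..\<tau>}"
  define N where "N z = (case z of (x, y, t) \<Rightarrow>
      (f x t - g y t - Q (x, t) - \<kappa> t * (norm (x - y))\<^sup>2) / exp (K * t))" for z
  have c\<kappa>: "continuous_on UNIV \<kappa>"
    using \<kappa>(1) by (meson DERIV_continuous_on has_field_derivative_at_within)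
  have cQ: "continuous_on UNIV Q" using C1_xt_imp_continuous_on[OF Q] .
  have "compact C" unfolding C_def by (intro compact_Times compact_cball compact_Icc)
  moreover have "continuous_on C N"
    unfolding C_def N_def case_prod_unfold
    by (intro continuous_intros
        continuous_on_compose2[OF cf[unfolded case_prod_unfold], of _ "\<lambda>z. (fst z, snd (snd z))", simplified]
        continuous_on_compose2[OF cg[unfolded case_prod_unfold], of _ "\<lambda>z. (fst (snd z), snd (snd z))", simplified]
        continuous_on_compose2[OF c\<kappa>] continuous_on_compose2[OF cQ]) auto
  moreover have C1: "(x1, y1, t1) \<in> C" using ex unfolding C_def by auto
  ultimately obtain z where z: "z \<in> C" "\<And>w. w \<in> C \<Longrightarrow> N w \<le> N z"
    using continuous_attains_sup[of C N] by blast
  obtain x2 y2 t2 where z_eq: "z = (x2, y2, t2)" by (cases z) auto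
  define m where "m = N z"
  have le: "f x t - g y t \<le> (Q (x, t) + m * exp (K * t)) + \<kappa> t * (norm (x - y))\<^sup>2"
    if "x \<in> cball a R" "y \<in> cball a R" "t \<in> {0..\<tau>}" for x y t
  proof -
    have "N (x, y, t) \<le> m" using z(2)[of "(x, y, t)"] that unfolding C_def m_def by auto
    then show ?thesis unfolding N_def by (simp add: field_simps)
  qed
  have "m0 \<le> N (x1, y1, t1)" using ex(4) unfolding N_def by (simp add: field_simps)
  then have m0: "m0 \<le> m" using z(2)[OF C1] unfolding m_def by linarith
  have box: "x2 \<in> cball a R" "y2 \<in> cball a R" "t2 \<in> {0..\<tau>}"
    using z(1) unfolding z_eq C_def by auto
  have eq: "f x2 t2 - g y2 t2 = (Q (x2, t2) + m * exp (K * t2)) + \<kappa> t2 * (norm (x2 - y2))\<^sup>2"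
    using m_def unfolding N_def z_eq by (simp add: field_simps)
  have dK: "((\<lambda>t. m * exp (K * t)) has_real_derivative K * m * exp (K * t)) (at t)" for t
    by (auto intro!: derivative_eq_intros)
  have Q': "C1_xt UNIV (\<lambda>z. Q z + m * exp (K * snd z)) (\<lambda>z. DQ z + 0) (\<lambda>z. Qt z + K * m * exp (K * snd z))"
    by (intro C1_xt_add[OF Q] C1_xt_time dK continuous_intros)
  \<comment> \<open>This is maximality against the pair \<open>(x, x)\<close>. Combined with the
    equality at \<open>(x, y)\<close> it bounds the penalty by the increment of \<open>g\<close>
    between the two points, which a Lipschitz estimate can then exploit.\<close>
  have diag: "f x t - g x t \<le> Q (x, t) + m * exp (K * t)" if "x \<in> cball a R" "t \<in> {0..\<tau>}" for x t
    using le[of x x t] that by simp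
  have int': "x \<in> ball a R \<and> y \<in> ball a R \<and> 0 < t \<and> t < \<tau>"
    if "x \<in> cball a R" "y \<in> cball a R" "t \<in> {0..\<tau>}"
      "f x t - g y t = (Q (x, t) + m * exp (K * t)) + \<kappa> t * (norm (x - y))\<^sup>2" for x y t
    using int[OF m0 that(1-3)] that diag by simp
  obtain x y t where "x \<in> ball a R" "y \<in> ball a R" "0 < t" "t < \<tau>"
    "f x t - g y t = (Q (x, t) + m * exp (K * t)) + \<kappa> t * (norm (x - y))\<^sup>2"
    "(Qt (x, t) + K * m * exp (K * t)) + \<kappa>' t * (norm (x - y))\<^sup>2 + F x t (f x t) ((DQ (x, t) + 0) + (2 * \<kappa> t) *\<^sub>R (x - y))
       - G y t (g y t) ((2 * \<kappa> t) *\<^sub>R (x - y)) \<le> 0"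
    by (rule viscosity_contact_inequality[OF Q' \<kappa>, where ?x1.0=x2 and ?y1.0=y2 and ?t1.0=t2])
      (use le int' box eq in auto)
  then show thesis using that[OF m0, of x y t] diag by auto
qed

end

subsection \<open>Cones of dependence and Lipschitz regularity\<close>

text \<open>The radius solves \<rho>' = A(|a| + \<rho>) + B. The right-hand side is the largest
  value of the speed A|x| + B in the ball of radius \<rho> about \<open>a\<close>, so the backward
  cone shrinks at least as fast as information can enter it.\<close>

lemma Rfun_has_derivative:
  assumes "A \<ge> 0"
  shows "(Rfun A B a has_real_derivative A * (norm a + Rfun A B a t) + B) (at t)"
proof (cases "A > 0")
  case True
  have "((\<lambda>t. (B / A + norm a) * (exp (A * t) - 1)) has_real_derivative
      (B / A + norm a) * (A * exp (A * t))) (at t)"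
    by (auto intro!: derivative_eq_intros)
  then show ?thesis
    using True by (simp add: Rfun_def[abs_def] field_simps)
next
  case False
  then have "A = 0" using assms by simp
  then show ?thesis by (auto simp: Rfun_def[abs_def] intro!: derivative_eq_intros)
qed

lemma Rfun_0 [simp]: "Rfun A B a 0 = 0"
  by (simp add: Rfun_def)

lemma Rfun_ge:
  assumes "A \<ge> 0" "B \<ge> 0" "t \<ge> 0"
  shows "B * t \<le> Rfun A B a t"
proof (cases "A > 0")
  case True
  have "B * t \<le> (B / A + norm a) * (A * t)"
    using True assms by (simp add: distrib_right)
  also have "\<dots> \<le> (B / A + norm a) * (exp (A * t) - 1)"
    using True assms exp_ge_add_one_self[of "A * t"] by (intro mult_left_mono) (auto simp: algebra_simps)
  finally show ?thesis using True by (simp add: Rfun_def)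
next
  case False
  then show ?thesis using assms by (simp add: Rfun_def)
qed

lemma Rfun_mono:
  assumes "A \<ge> 0" "B \<ge> 0" "s \<le> t"
  shows "Rfun A B a s \<le> Rfun A B a t"
  using assms by (auto simp: Rfun_def intro!: mult_left_mono)

text \<open>\<open>P\<close> is a multiple of the squared positive part of |x - a|^2 + c -
  \<rho>(t)^2, with \<rho>(t) the radius of the backward cone. Inside the cone |x - a| \<le> \<rho>
  and A|x| + B \<le> -\<rho>', so the time derivative of \<open>P\<close> dominates speed times
  gradient: \<open>P\<close> absorbs the transport error from (H2) while keeping maximum points
  inside the cone.\<close>

lemma cone_barrier:
  fixes a :: "'a::euclidean_space"
  assumes "A \<ge> 0" "B \<ge> 0" "c > 0" "N \<ge> 0"
  obtains P :: "'a \<times> real \<Rightarrow> real" and DP Pt where "C1_xt UNIV P DP Pt" "\<And>z. P z \<ge> 0"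
    "\<And>x t. (norm (x - a))\<^sup>2 + c \<le> (Rfun A B a (\<tau> - t))\<^sup>2 \<Longrightarrow> P (x, t) = 0"
    "\<And>x t. t \<le> \<tau> \<Longrightarrow> norm (x - a) \<ge> Rfun A B a (\<tau> - t) \<Longrightarrow> P (x, t) \<ge> N"
    "\<And>x t. t \<le> \<tau> \<Longrightarrow> norm (x - a) < Rfun A B a (\<tau> - t) \<Longrightarrow>
       (A * norm x + B) * norm (DP (x, t)) \<le> Pt (x, t)"
proof -
  define \<rho> where "\<rho> t = Rfun A B a (\<tau> - t)" for t
  define \<rho>' where "\<rho>' t = - (A * (norm a + \<rho> t) + B)" for t
  \<comment> \<open>On and outside the lateral boundary the quantity under the positive part is at
    least \<open>c\<close>, so this factor raises \<open>P\<close> to at least \<open>N\<close>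
    there.\<close>
  define M where "M = N / c\<^sup>2"
  have M: "M \<ge> 0" using assms unfolding M_def by auto
  have d\<rho>: "(\<rho> has_real_derivative \<rho>' t) (at t)" for t
    unfolding \<rho>_def \<rho>'_def
    by (rule DERIV_cong[OF DERIV_chain2[where f = "Rfun A B a" and g = "\<lambda>t. \<tau> - t" and Db = "-1"]],
        rule Rfun_has_derivative[OF assms(1)]) (auto intro!: derivative_eq_intros)
  then have c\<rho>: "continuous_on UNIV \<rho>"
    by (meson DERIV_continuous_on has_field_derivative_at_within)
  have c\<rho>': "continuous_on UNIV \<rho>'" unfolding \<rho>'_def by (intro continuous_intros c\<rho>)
  have d2: "((\<lambda>t. c - (\<rho> t)\<^sup>2) has_real_derivative - 2 * \<rho> t * \<rho>' t) (at t)" for t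
    using d\<rho>[of t] by (auto intro!: derivative_eq_intros)
  define Z where "Z z = (norm (fst z - a - snd z *\<^sub>R 0))\<^sup>2 + (c - (\<rho> (snd z))\<^sup>2)" for z
  have CZ: "C1_xt UNIV Z (\<lambda>z. 2 *\<^sub>R (fst z - a - snd z *\<^sub>R 0) + 0)
      (\<lambda>z. - 2 * ((fst z - a - snd z *\<^sub>R 0) \<bullet> 0) + (- 2 * \<rho> (snd z) * \<rho>' (snd z)))"
    unfolding Z_def by (intro C1_xt_add C1_xt_norm_square C1_xt_time d2 continuous_intros c\<rho> c\<rho>')
  have dk: "((\<lambda>v. M * (max 0 v)\<^sup>2) has_real_derivative M * (2 * max 0 v)) (at v)" for v
    by (intro DERIV_cmult max0_square_has_derivative)
  have ck: "continuous_on UNIV (\<lambda>v. M * (2 * max 0 v) :: real)"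
    by (intro continuous_intros)
  note CP = C1_xt_compose[OF CZ dk ck]
  show thesis
  proof (rule that[OF CP])
    show "0 \<le> M * (max 0 (Z z))\<^sup>2" for z using M by simp
    show "M * (max 0 (Z (x, t)))\<^sup>2 = 0" if "(norm (x - a))\<^sup>2 + c \<le> (Rfun A B a (\<tau> - t))\<^sup>2" for x t
      using that unfolding Z_def \<rho>_def by simp
    show "N \<le> M * (max 0 (Z (x, t)))\<^sup>2" if "t \<le> \<tau>" "norm (x - a) \<ge> Rfun A B a (\<tau> - t)" for x t
    proof -
      have "0 \<le> \<rho> t" using Rfun_mono[OF assms(1,2), of 0 "\<tau> - t" a] that unfolding \<rho>_def by simp
      then have "(\<rho> t)\<^sup>2 \<le> (norm (x - a))\<^sup>2" using that unfolding \<rho>_def by (intro power_mono)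
      then have "c \<le> Z (x, t)" unfolding Z_def by simp
      then have "c\<^sup>2 \<le> (max 0 (Z (x, t)))\<^sup>2" using assms by (intro power_mono) auto
      then have "M * c\<^sup>2 \<le> M * (max 0 (Z (x, t)))\<^sup>2" using M by (rule mult_left_mono)
      then show ?thesis using assms unfolding M_def by simp
    qed
    show "(A * norm x + B) * norm ((M * (2 * max 0 (Z (x, t)))) *\<^sub>R
        (2 *\<^sub>R (fst (x, t) - a - snd (x, t) *\<^sub>R 0) + 0))
      \<le> M * (2 * max 0 (Z (x, t))) * (- 2 * ((fst (x, t) - a - snd (x, t) *\<^sub>R 0) \<bullet> 0)
          + - 2 * \<rho> (snd (x, t)) * \<rho>' (snd (x, t)))"
      if "t \<le> \<tau>" "norm (x - a) < Rfun A B a (\<tau> - t)" for x t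
    proof -
      define k where "k = M * (2 * max 0 (Z (x, t)))"
      have k: "k \<ge> 0" using M unfolding k_def by simp
      have lt: "norm (x - a) \<le> \<rho> t" using that unfolding \<rho>_def by simp
      have "norm x \<le> norm a + \<rho> t" using lt norm_triangle_ineq2[of x a] by linarith
      then have "A * norm x + B \<le> - \<rho>' t" using assms unfolding \<rho>'_def by (simp add: mult_left_mono)
      moreover have "0 \<le> A * norm x + B" using assms by simp
      ultimately have "(A * norm x + B) * norm (x - a) \<le> (- \<rho>' t) * \<rho> t"
        using lt by (intro mult_mono) auto
      then have "k * ((A * norm x + B) * norm (x - a)) \<le> k * ((- \<rho>' t) * \<rho> t)"
        using k by (intro mult_left_mono) auto
      moreover have "norm (k *\<^sub>R (2 *\<^sub>R (fst (x, t) - a - snd (x, t) *\<^sub>R 0) + 0)) = 2 * k * norm (x - a)"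
        using k by simp
      ultimately show ?thesis unfolding k_def[symmetric] using k by (simp add: mult_ac)
    qed
  qed
qed

section \<open>The Cauchy problem and the local Lipschitz bound in space\<close>

locale hamilton_jacobi =
  fixes H :: "'a::euclidean_space \<Rightarrow> real \<Rightarrow> real \<Rightarrow> 'a \<Rightarrow> real"
    and u0 :: "'a \<Rightarrow> real" and u :: "'a \<Rightarrow> real \<Rightarrow> real"
    and T C1 \<beta> A2 B2 K3 L :: real
  assumes H_cont: "continuous_on (UNIV \<times> {0..T} \<times> UNIV \<times> UNIV) (\<lambda>(x, t, v, p). H x t v p)"
    and u0_lip: "L-lipschitz_on UNIV u0"
    and H1: "C1 \<ge> 0" "\<beta> \<in> {0, 1}"
      "\<And>x y t v p. t \<in> {0..T} \<Longrightarrow> \<bar>H x t v p - H y t v p\<bar> \<le> C1 * (\<beta> + norm p) * norm (x - y)"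
    and H2: "A2 \<ge> 0" "B2 \<ge> 0"
      "\<And>x t v p q. t \<in> {0..T} \<Longrightarrow> \<bar>H x t v p - H x t v q\<bar> \<le> (A2 * norm x + B2) * norm (p - q)"
    and H3: "K3 \<ge> 0"
      "\<And>x t v w p. t \<in> {0..T} \<Longrightarrow> \<bar>H x t v p - H x t w p\<bar> \<le> K3 * \<bar>v - w\<bar>"
    and H4: "\<And>x t v. t \<in> {0..T} \<Longrightarrow> convex_on UNIV (H x t v)"
    and sol: "viscosity_solution H u0 T u"
begin

lemma u_cont: "continuous_on (UNIV \<times> {0..<T}) (\<lambda>(x, t). u x t)"
  and u_init: "u x 0 = u0 x"
  using sol unfolding viscosity_solution_def by auto

lemma H_diff_ge:
  assumes "t \<in> {0..T}" "B \<ge> B2"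
  shows "H x t v (e + p) - H y t w p \<ge>
    - (A2 * norm x + B) * norm e - C1 * (\<beta> + norm p) * norm (x - y) - K3 * \<bar>v - w\<bar>"
proof -
  have "\<bar>H x t v (e + p) - H x t v p\<bar> \<le> (A2 * norm x + B2) * norm e"
    using H2(3)[OF assms(1), of x v "e + p" p] by simp
  also have "\<dots> \<le> (A2 * norm x + B) * norm e"
    using assms by (intro mult_right_mono) auto
  finally show ?thesis
    using H1(3)[OF assms(1), of x v p y] H3(2)[OF assms(1), of y v p w]
    unfolding minus_mult_left[symmetric] by linarith
qed

text \<open>The solution is compared with itself at two points under a penalty of size 1/\<epsilon>.
  The outcome is a bound of the form |x - y|^2 / (2 \<epsilon>) plus a multiple of \<epsilon>, and
  the choice \<epsilon> = |x - y| makes it linear.\<close>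

lemma u_lipschitz_in_x:
  assumes "0 \<le> \<tau>" "\<tau> < T"
  obtains D where "D \<ge> 0"
    "\<And>x y t. x \<in> cball a R0 \<Longrightarrow> y \<in> cball a R0 \<Longrightarrow> t \<in> {0..\<tau>} \<Longrightarrow> \<bar>u x t - u y t\<bar> \<le> D * norm (x - y)"
proof -
  \<comment> \<open>The cone closes at a time after \<tau>, so that it is still wide at \<tau>, and
    before \<open>T\<close>, so that \<open>u\<close> is continuous up to its tip.\<close>
  define \<tau>3 where "\<tau>3 = (\<tau> + T) / 2"
  have \<tau>3: "\<tau> < \<tau>3" "\<tau>3 < T" "0 < \<tau>3" using assms unfolding \<tau>3_def by auto
  \<comment> \<open>The speed is increased until the cone has radius at least
    \<open>\<bar>R0\<bar> + 1\<close> at all times up to \<tau>.\<close>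
  define B where "B = B2 + (\<bar>R0\<bar> + 1) / (\<tau>3 - \<tau>)"
  have B: "B \<ge> B2" "B \<ge> 0" using \<tau>3 H2(2) unfolding B_def by auto
  define \<rho> where "\<rho> t = Rfun A2 B a (\<tau>3 - t)" for t
  have \<rho>_mono: "\<rho> t \<le> \<rho> s" if "s \<le> t" for s t
    unfolding \<rho>_def using that by (intro Rfun_mono H2(1) B(2)) auto
  have \<rho>_ge: "\<rho> t \<ge> \<bar>R0\<bar> + 1" if "t \<le> \<tau>" for t
  proof -
    have "B * (\<tau>3 - \<tau>) = B2 * (\<tau>3 - \<tau>) + (\<bar>R0\<bar> + 1)"
      using \<tau>3 unfolding B_def distrib_right[of B2] by simp
    then have "\<bar>R0\<bar> + 1 \<le> B * (\<tau>3 - \<tau>)" using \<tau>3 H2(2) by simp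
    also have "\<dots> \<le> \<rho> \<tau>" unfolding \<rho>_def using \<tau>3 by (intro Rfun_ge H2(1) B(2)) auto
    also have "\<dots> \<le> \<rho> t" using \<rho>_mono that by blast
    finally show ?thesis .
  qed
  define R where "R = \<rho> 0 + 1"
  have \<rho>0: "\<rho> 0 \<ge> \<bar>R0\<bar> + 1" using \<rho>_ge assms by blast
  have cu: "continuous_on (cball a R \<times> {0..\<tau>3}) (\<lambda>(x, t). u x t)"
    by (rule continuous_on_subset[OF u_cont]) (use \<tau>3 in auto)
  have cH: "continuous_on (UNIV \<times> {0..\<tau>3} \<times> UNIV \<times> UNIV) (\<lambda>(x, t, v, p). H x t v p)"
    by (rule continuous_on_subset[OF H_cont]) (use \<tau>3 in auto)
  have "compact ((\<lambda>(x, t). u x t) ` (cball a R \<times> {0..\<tau>3}))"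
    by (intro compact_continuous_image cu compact_Times compact_cball compact_Icc)
  then obtain M where M: "\<And>x t. x \<in> cball a R \<Longrightarrow> t \<in> {0..\<tau>3} \<Longrightarrow> \<bar>u x t\<bar> \<le> M"
    by (force dest!: compact_imp_bounded simp: bounded_iff)
  have M0: "M \<ge> 0" using M[of a 0] \<rho>0 \<tau>3 unfolding R_def by auto
  obtain P :: "'a \<times> real \<Rightarrow> real" and DP Pt where P: "C1_xt UNIV P DP Pt" "\<And>z. P z \<ge> 0"
    "\<And>x t. (norm (x - a))\<^sup>2 + 1 \<le> (\<rho> t)\<^sup>2 \<Longrightarrow> P (x, t) = 0"
    "\<And>x t. t \<le> \<tau>3 \<Longrightarrow> norm (x - a) \<ge> \<rho> t \<Longrightarrow> P (x, t) \<ge> 2 * M + 1"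
    "\<And>x t. t \<le> \<tau>3 \<Longrightarrow> norm (x - a) < \<rho> t \<Longrightarrow> (A2 * norm x + B) * norm (DP (x, t)) \<le> Pt (x, t)"
    using cone_barrier[of A2 B 1 "2 * M + 1" a \<tau>3] H2(1) B M0 unfolding \<rho>_def by auto
  \<comment> \<open>The exponential must pay \<open>K3\<close> for (H3) and \<open>3 * C1\<close>
    for (H1): one \<open>C1\<close> for the term with \<beta>, and two for the penalty gradient,
    whose product with |x - y| is twice the penalty. The remaining 1 yields the strict
    contradiction.\<close>
  define K where "K = K3 + 3 * C1 + 1"
  have K: "K > 0" using H1(1) H3(1) unfolding K_def by auto
  \<comment> \<open>This makes |x - y| < 1 at every contact point, and hence puts \<open>y\<close>
    in the ball of radius \<open>R\<close>, which exceeds the cone by 1.\<close>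
  define \<epsilon>0 where "\<epsilon>0 = 1 / (4 * M + 1)"
  have \<epsilon>0: "\<epsilon>0 > 0" "4 * \<epsilon>0 * M < 1" using M0 unfolding \<epsilon>0_def by (auto simp: field_simps)
  have main: "u x1 t1 - u y1 t1 \<le> exp (K * t1) * ((norm (x1 - y1))\<^sup>2 / (2 * \<epsilon>) + \<epsilon> * (L\<^sup>2 + 1) / 2 + P (x1, t1))"
    if \<epsilon>: "0 < \<epsilon>" "\<epsilon> \<le> \<epsilon>0" and p1: "x1 \<in> cball a R" "y1 \<in> cball a R" "t1 \<in> {0..\<tau>3}" for \<epsilon> x1 y1 t1
  proof (rule ccontr)
    assume neg: "\<not> ?thesis"
    \<comment> \<open>The part with \<open>L\<^sup>2\<close> absorbs the Lipschitz increment of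
      \<open>u0\<close> at time 0; the additional 1 absorbs |x - y| itself in the \<beta> term of
      (H1). Both use Young's inequality.\<close>
    define c where "c = \<epsilon> * (L\<^sup>2 + 1) / 2"
    define m0 where "m0 = (u x1 t1 - u y1 t1) / exp (K * t1) - ((norm (x1 - y1))\<^sup>2 / (2 * \<epsilon>) + c + P (x1, t1))"
    have m0: "m0 > 0" using neg unfolding m0_def c_def by (simp add: field_simps)
    define \<kappa> where "\<kappa> t = exp (K * t) * (1 / (2 * \<epsilon>))" for t
    have d\<kappa>: "(\<kappa> has_real_derivative K * \<kappa> t) (at t)" for t
      unfolding \<kappa>_def using \<epsilon> by (auto intro!: derivative_eq_intros)
    have c\<kappa>: "continuous_on UNIV (\<lambda>t. K * \<kappa> t)" unfolding \<kappa>_def by (intro continuous_intros)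
    have dE: "((\<lambda>t. exp (K * t)) has_real_derivative K * exp (K * t)) (at t)" for t
      by (auto intro!: derivative_eq_intros)
    have dc: "((\<lambda>t. c) has_real_derivative 0) (at t)" for t by simp
    have Q: "C1_xt UNIV (\<lambda>z. exp (K * snd z) * (c + P z)) (\<lambda>z. exp (K * snd z) *\<^sub>R DP z)
        (\<lambda>z. exp (K * snd z) * Pt z + K * exp (K * snd z) * (c + P z))"
      using C1_xt_mult[OF C1_xt_time[OF dE] C1_xt_add[OF C1_xt_time[OF dc] P(1)]]
      by (simp add: continuous_intros algebra_simps)
    have facts: "x \<in> ball a R \<and> y \<in> ball a R \<and> 0 < t \<and> t < \<tau>3 \<and> norm (x - a) < \<rho> t"
      if "m \<ge> m0" and box: "x \<in> cball a R" "y \<in> cball a R" "t \<in> {0..\<tau>3}"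
        and eq: "u x t - u y t = exp (K * snd (x, t)) * (c + P (x, t)) + \<kappa> t * (norm (x - y))\<^sup>2 + m * exp (K * t)"
      for m x y t
    proof -
      have E: "exp (K * t) \<ge> 1" using box K by auto
      have sum: "u x t - u y t = exp (K * t) * ((norm (x - y))\<^sup>2 / (2 * \<epsilon>) + c + P (x, t) + m)"
        unfolding eq \<kappa>_def by (simp add: field_simps)
      have nn: "(norm (x - y))\<^sup>2 / (2 * \<epsilon>) \<ge> 0" "c \<ge> 0" "P (x, t) \<ge> 0" "m > 0"
        using \<epsilon> P(2) m0 that(1) unfolding c_def by auto
      have "(norm (x - y))\<^sup>2 / (2 * \<epsilon>) + c + P (x, t) + m \<le> u x t - u y t"
        unfolding sum using mult_right_mono[OF E, of "(norm (x - y))\<^sup>2 / (2 * \<epsilon>) + c + P (x, t) + m"] nn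
        by simp
      also have "\<dots> \<le> 2 * M" using M[OF box(1,3)] M[OF box(2,3)] by linarith
      finally have le: "(norm (x - y))\<^sup>2 / (2 * \<epsilon>) + c + P (x, t) + m \<le> 2 * M" .
      have lt: "norm (x - a) < \<rho> t"
      proof (rule ccontr)
        assume "\<not> norm (x - a) < \<rho> t"
        then have "P (x, t) \<ge> 2 * M + 1" using P(4)[of t x] box by auto
        then show False using le nn by linarith
      qed
      have "\<rho> t \<le> \<rho> 0" using \<rho>_mono box by auto
      then have x: "x \<in> ball a (\<rho> 0)" using lt by (simp add: dist_norm norm_minus_commute)
      have "(norm (x - y))\<^sup>2 / (2 * \<epsilon>) \<le> 2 * M" using le nn by linarith
      then have "(norm (x - y))\<^sup>2 \<le> 2 * M * (2 * \<epsilon>)" using \<epsilon> by (simp add: pos_divide_le_eq)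
      also have "\<dots> \<le> 4 * \<epsilon>0 * M" using mult_right_mono[OF \<epsilon>(2) M0] by (simp add: mult_ac)
      also have "\<dots> < 1" by (rule \<epsilon>0)
      finally have "norm (x - y) < 1" by (simp add: power2_less_1_iff)
      then have y: "y \<in> ball a R"
        using x dist_triangle[of a y x] unfolding R_def by (simp add: dist_norm)
      have "t \<noteq> \<tau>3" using lt unfolding \<rho>_def by auto
      moreover have "t \<noteq> 0"
      proof
        assume "t = 0"
        have "u x 0 - u y 0 \<le> L * norm (x - y)"
          using lipschitz_onD[OF u0_lip, of x y] by (simp add: u_init dist_norm)
        also have "\<dots> \<le> (norm (x - y))\<^sup>2 / (2 * \<epsilon>) + \<epsilon> * L\<^sup>2 / 2"
        proof -
          have "0 \<le> (norm (x - y) - \<epsilon> * L)\<^sup>2 / (2 * \<epsilon>)" using \<epsilon> by simp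
          also have "\<dots> = (norm (x - y))\<^sup>2 / (2 * \<epsilon>) + \<epsilon> * L\<^sup>2 / 2 - L * norm (x - y)"
            using \<epsilon> by (simp add: field_simps power2_eq_square)
          finally show ?thesis by simp
        qed
        also have "\<dots> \<le> (norm (x - y))\<^sup>2 / (2 * \<epsilon>) + c"
          using \<epsilon> unfolding c_def by (simp add: field_simps)
        finally show False using sum nn \<open>t = 0\<close> by simp
      qed
      ultimately show ?thesis using x y lt box unfolding R_def by auto
    qed
    have viol: "u x1 t1 - u y1 t1 \<ge> exp (K * snd (x1, t1)) * (c + P (x1, t1)) + \<kappa> t1 * (norm (x1 - y1))\<^sup>2 + m0 * exp (K * t1)"
      unfolding m0_def \<kappa>_def by (simp add: field_simps)
    obtain m x y t where c1: "m \<ge> m0" "x \<in> ball a R" "y \<in> ball a R" "0 < t" "t < \<tau>3"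
      "u x t - u y t = exp (K * snd (x, t)) * (c + P (x, t)) + \<kappa> t * (norm (x - y))\<^sup>2 + m * exp (K * t)"
      "exp (K * snd (x, t)) * Pt (x, t) + K * exp (K * snd (x, t)) * (c + P (x, t)) + K * m * exp (K * t)
         + K * \<kappa> t * (norm (x - y))\<^sup>2
         + H x t (u x t) (exp (K * snd (x, t)) *\<^sub>R DP (x, t) + (2 * \<kappa> t) *\<^sub>R (x - y))
         - H y t (u y t) ((2 * \<kappa> t) *\<^sub>R (x - y)) \<le> 0"
      by (rule viscosity_contact_exponential[OF cu cu cH cH _ _ Q d\<kappa> c\<kappa> _ p1 viol])
        (use facts \<tau>3 viscosity_solution_imp_sub_super[OF sol] in auto)
    define \<Theta> where "\<Theta> = u x t - u y t"
    define d where "d = norm (x - y)"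
    have E: "exp (K * t) \<ge> 1" using c1 K by auto
    have \<kappa>0: "\<kappa> t \<ge> 0" using \<epsilon> unfolding \<kappa>_def by auto
    have lt: "norm (x - a) < \<rho> t" using facts[OF c1(1) _ _ _ c1(6)] c1 by auto
    have c0: "c \<ge> 0" unfolding c_def using \<epsilon> by simp
    have m: "m > 0" using m0 c1 by simp
    have \<Theta>: "\<Theta> = exp (K * t) * (c + P (x, t)) + \<kappa> t * d\<^sup>2 + m * exp (K * t)"
      using c1(6) unfolding \<Theta>_def d_def by simp
    have parts: "\<kappa> t * d\<^sup>2 \<ge> 0" "exp (K * t) * P (x, t) \<ge> 0" "m * exp (K * t) > 0" "exp (K * t) * c \<ge> c"
      using \<kappa>0 P(2) m c0 E mult_right_mono[OF E c0] by auto
    have \<Theta>_pos: "\<Theta> > 0" unfolding \<Theta> using parts c0 by (simp add: algebra_simps)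
    have "H x t (u x t) (exp (K * t) *\<^sub>R DP (x, t) + (2 * \<kappa> t) *\<^sub>R (x - y)) - H y t (u y t) ((2 * \<kappa> t) *\<^sub>R (x - y))
      \<ge> - (A2 * norm x + B) * norm (exp (K * t) *\<^sub>R DP (x, t))
         - C1 * (\<beta> + norm ((2 * \<kappa> t) *\<^sub>R (x - y))) * norm (x - y) - K3 * \<bar>u x t - u y t\<bar>"
      using c1 \<tau>3 B by (intro H_diff_ge) auto
    moreover have "(A2 * norm x + B) * norm (exp (K * t) *\<^sub>R DP (x, t)) \<le> exp (K * t) * Pt (x, t)"
      using mult_left_mono[OF P(5)[of t x], of "exp (K * t)"] lt c1 by (simp add: algebra_simps)
    moreover have "C1 * (\<beta> + norm ((2 * \<kappa> t) *\<^sub>R (x - y))) * norm (x - y) \<le> 3 * C1 * \<Theta>"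
    proof -
      have "d \<le> d\<^sup>2 / (2 * \<epsilon>) + \<epsilon> / 2"
      proof -
        have "0 \<le> (d - \<epsilon>)\<^sup>2 / (2 * \<epsilon>)" using \<epsilon> by simp
        also have "\<dots> = d\<^sup>2 / (2 * \<epsilon>) + \<epsilon> / 2 - d"
          using \<epsilon> by (simp add: field_simps power2_eq_square)
        finally show ?thesis by simp
      qed
      also have "\<dots> \<le> \<kappa> t * d\<^sup>2 + c"
      proof -
        have "d\<^sup>2 / (2 * \<epsilon>) \<le> \<kappa> t * d\<^sup>2"
          using mult_right_mono[OF E, of "d\<^sup>2 / (2 * \<epsilon>)"] \<epsilon> unfolding \<kappa>_def by (simp add: field_simps)
        moreover have "\<epsilon> / 2 \<le> c" using \<epsilon> unfolding c_def by (simp add: field_simps)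
        ultimately show ?thesis by simp
      qed
      also have "\<dots> \<le> \<Theta>" unfolding \<Theta> using parts by (simp add: algebra_simps)
      finally have "d \<le> \<Theta>" .
      moreover have "\<beta> * d \<le> 1 * d" using H1(2) unfolding d_def by (intro mult_right_mono) auto
      ultimately have 1: "\<beta> * d \<le> \<Theta>" by simp
      have "norm ((2 * \<kappa> t) *\<^sub>R (x - y)) * d = 2 * (\<kappa> t * d\<^sup>2)"
        using \<kappa>0 unfolding d_def by (simp add: power2_eq_square)
      also have "\<dots> \<le> 2 * \<Theta>" unfolding \<Theta> using parts c0 by (simp add: algebra_simps)
      finally have "(\<beta> + norm ((2 * \<kappa> t) *\<^sub>R (x - y))) * d \<le> 3 * \<Theta>"
        using 1 by (simp add: algebra_simps)
      from mult_left_mono[OF this H1(1)] show ?thesis unfolding d_def by (simp add: algebra_simps)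
    qed
    moreover have "K3 * \<bar>u x t - u y t\<bar> = K3 * \<Theta>" using \<Theta>_pos unfolding \<Theta>_def by simp
    moreover have "exp (K * t) * Pt (x, t) + K * \<Theta>
         + H x t (u x t) (exp (K * t) *\<^sub>R DP (x, t) + (2 * \<kappa> t) *\<^sub>R (x - y))
         - H y t (u y t) ((2 * \<kappa> t) *\<^sub>R (x - y)) \<le> 0"
      using c1(7) unfolding \<Theta> d_def by (simp add: algebra_simps)
    ultimately have "K * \<Theta> - 3 * C1 * \<Theta> - K3 * \<Theta> \<le> 0" by linarith
    then show False using \<Theta>_pos unfolding K_def by (simp add: algebra_simps)
  qed
  \<comment> \<open>The first summand serves pairs at distance at most \<epsilon>0, the second
    serves distant pairs through the bound \<open>M\<close> alone.\<close>
  define D where "D = exp (K * T) * (L\<^sup>2 + 2) + 2 * M / \<epsilon>0"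
  have D: "exp (K * T) * (L\<^sup>2 + 2) \<le> D" "2 * M / \<epsilon>0 \<le> D" "D \<ge> 0"
    using M0 \<epsilon>0 unfolding D_def by auto
  have one: "u x t - u y t \<le> D * norm (x - y)"
    if xyt: "x \<in> cball a R0" "y \<in> cball a R0" "t \<in> {0..\<tau>}" for x y t
  proof -
    have box: "x \<in> cball a R" "y \<in> cball a R" "t \<in> {0..\<tau>3}" using xyt \<rho>0 \<tau>3 unfolding R_def by auto
    consider "x = y" | "norm (x - y) > \<epsilon>0" | "norm (x - y) > 0" "norm (x - y) \<le> \<epsilon>0" by force
    then show ?thesis
    proof cases
      case 1
      then show ?thesis by simp
    next
      case 2
      have "u x t - u y t \<le> 2 * M / \<epsilon>0 * \<epsilon>0"
        using M[OF box(1,3)] M[OF box(2,3)] \<epsilon>0 by simp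
      also have "\<dots> \<le> D * norm (x - y)" using 2 D \<epsilon>0 M0 by (intro mult_mono) auto
      finally show ?thesis .
    next
      case 3
      let ?d = "norm (x - y)"
      have "norm (x - a) \<le> \<bar>R0\<bar>" using xyt by (simp add: dist_norm norm_minus_commute)
      then have "(norm (x - a))\<^sup>2 + 1 \<le> \<bar>R0\<bar>\<^sup>2 + 1" by (intro add_mono power_mono) auto
      also have "\<dots> \<le> (\<bar>R0\<bar> + 1)\<^sup>2" by (simp add: power2_sum)
      also have "\<dots> \<le> (\<rho> t)\<^sup>2" using \<rho>_ge[of t] xyt by (intro power_mono) auto
      finally have P0: "P (x, t) = 0" by (rule P(3))
      have "u x t - u y t \<le> exp (K * t) * (?d\<^sup>2 / (2 * ?d) + ?d * (L\<^sup>2 + 1) / 2 + P (x, t))"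
        by (rule main[OF 3 box])
      also have "\<dots> = exp (K * t) * ((L\<^sup>2 + 2) / 2 * ?d)"
        using 3 unfolding P0 by (simp add: power2_eq_square algebra_simps add_divide_distrib)
      also have "\<dots> \<le> exp (K * T) * ((L\<^sup>2 + 2) * ?d)"
        using box \<tau>3 K by (intro mult_mono) auto
      also have "\<dots> \<le> D * ?d" using mult_right_mono[OF D(1), of ?d] by (simp add: algebra_simps)
      finally show ?thesis .
    qed
  qed
  have "\<bar>u x t - u y t\<bar> \<le> D * norm (x - y)"
    if "x \<in> cball a R0" "y \<in> cball a R0" "t \<in> {0..\<tau>}" for x y t
    using one[OF that] one[OF that(2,1,3)] by (auto simp: abs_le_iff norm_minus_commute)
  then show thesis using that D(3) by blast
qed


text \<open>A subsolution of a convex equation obeys the dynamic programming inequality along the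
  characteristic direction \<open>q\<close> of each affine minorant \<open>p \<mapsto> q \<bullet> p - (q \<bullet> p0 - H p0)\<close> of \<open>H\<close>;
  the Lipschitz bound makes the minorant uniform near the base point.\<close>

lemma u_transport:
  assumes s0: "0 < s0" "s0 < T" and e: "e > 0"
    and q: "\<And>p. H y0 s0 (u y0 s0) p \<ge> H y0 s0 (u y0 s0) p0 + q \<bullet> (p - p0)"
  obtains \<eta> where "\<eta> > 0"
    "\<And>y s \<delta>. norm (y - y0) < \<eta> \<Longrightarrow> \<bar>s - s0\<bar> < \<eta> \<Longrightarrow> 0 < \<delta> \<Longrightarrow> \<delta> < \<eta> \<Longrightarrow>
       u (y + \<delta> *\<^sub>R q) (s + \<delta>) \<le> u y s + \<delta> * (q \<bullet> p0 - H y0 s0 (u y0 s0) p0 + e)"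
proof -
  define \<tau> where "\<tau> = (s0 + T) / 2"
  have \<tau>: "s0 < \<tau>" "\<tau> < T" "0 < \<tau>" using s0 unfolding \<tau>_def by auto
  obtain D where D: "D \<ge> 0" "\<And>x y t. x \<in> cball y0 1 \<Longrightarrow> y \<in> cball y0 1 \<Longrightarrow> t \<in> {0..\<tau>} \<Longrightarrow>
      \<bar>u x t - u y t\<bar> \<le> D * norm (x - y)"
    using u_lipschitz_in_x[of \<tau> y0 1] \<tau> by auto
  have cu: "continuous_on (cball y0 1 \<times> {0..\<tau>}) (\<lambda>(x, t). u x t)"
    by (rule continuous_on_subset[OF u_cont]) (use \<tau> in auto)
  \<comment> \<open>Slopes of norm at most \<open>2 * D\<close> suffice, since the Lipschitz bound
    will force the penalty gradient at the maximum point into this ball; the restriction makes the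
    set compact.\<close>
  let ?C = "cball y0 1 \<times> {0..\<tau>} \<times> cball (0::'a) (2 * D)"
  let ?h = "\<lambda>(x, t, p). H x t (u x t) p"
  have "continuous_on ?C ?h"
  proof -
    have "continuous_on ?C (\<lambda>z. (fst z, fst (snd z), u (fst z) (fst (snd z)), snd (snd z)))"
      by (intro continuous_intros continuous_on_compose2[OF cu[unfolded case_prod_unfold],
          of _ "\<lambda>z. (fst z, fst (snd z))", simplified]) auto
    then have "continuous_on ?C (\<lambda>z. case (fst z, fst (snd z), u (fst z) (fst (snd z)), snd (snd z))
        of (x, t, v, p) \<Rightarrow> H x t v p)"
      by (rule continuous_on_compose2[OF H_cont]) (use \<tau> in auto)
    then show ?thesis by (simp add: case_prod_unfold)
  qed
  then have uc: "uniformly_continuous_on ?C ?h"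
    by (intro compact_uniformly_continuous compact_Times compact_cball compact_Icc)
  have e2: "0 < e / 2" using e by simp
  obtain \<rho> where \<rho>: "\<rho> > 0" "\<And>z w. z \<in> ?C \<Longrightarrow> w \<in> ?C \<Longrightarrow> dist w z < \<rho> \<Longrightarrow> dist (?h w) (?h z) < e / 2"
    using uc[unfolded uniformly_continuous_on_def, THEN spec, THEN mp, OF e2] by blast
  define \<rho>1 where "\<rho>1 = min (\<rho> / 2) (min 1 (min s0 (\<tau> - s0)))"
  have \<rho>1: "\<rho>1 > 0" "\<rho>1 \<le> \<rho> / 2" "\<rho>1 \<le> 1" "\<rho>1 \<le> s0" "\<rho>1 \<le> \<tau> - s0"
    using \<rho>(1) s0 \<tau> unfolding \<rho>1_def by linarith+
  define H0 where "H0 = H y0 s0 (u y0 s0) p0"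
  have lower: "H x t (u x t) p > H0 + q \<bullet> (p - p0) - e / 2"
    if "norm (x - y0) < \<rho>1" "\<bar>t - s0\<bar> < \<rho>1" "norm p \<le> 2 * D" for x t p
  proof -
    have "dist (x, t, p) (y0, s0, p) \<le> dist x y0 + dist t s0"
      by (simp add: dist_Pair_Pair sqrt_sum_squares_le_sum)
    also have "\<dots> < \<rho>" using that \<rho>1 by (simp add: dist_norm)
    finally have "dist (x, t, p) (y0, s0, p) < \<rho>" .
    then have "dist (?h (x, t, p)) (?h (y0, s0, p)) < e / 2"
      by (intro \<rho>(2)) (use that \<rho>1 s0 \<tau> in \<open>auto simp: dist_norm norm_minus_commute\<close>)
    then have "\<bar>H x t (u x t) p - H y0 s0 (u y0 s0) p\<bar> < e / 2" by (simp add: dist_real_def)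
    then show ?thesis using q[of p] unfolding H0_def by linarith
  qed
  \<comment> \<open>A segment of duration \<open>2 * \<delta>\<close> started within \<eta> of
    \<open>y0\<close> then stays within \<open>\<rho>1 / 3\<close> of it, and its times stay within
    \<rho>1 of \<open>s0\<close>.\<close>
  define \<eta> where "\<eta> = \<rho>1 / (6 * (1 + norm q))"
  have nq: "1 + norm q > 0" using norm_ge_zero[of q] by linarith
  have \<eta>: "\<eta> > 0" "\<eta> * (1 + norm q) = \<rho>1 / 6"
    using \<rho>1(1) nq unfolding \<eta>_def by (simp_all add: field_simps)
  have \<eta>q: "\<eta> + \<eta> * norm q = \<rho>1 / 6" using \<eta>(2) by (simp add: algebra_simps)
  have "\<eta> * norm q \<ge> 0" using \<eta> by simp
  define c where "c = q \<bullet> p0 - H0 + e"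
  have "u (y + \<delta> *\<^sub>R q) (s + \<delta>) \<le> u y s + \<delta> * c"
    if y: "norm (y - y0) < \<eta>" and s: "\<bar>s - s0\<bar> < \<eta>" and \<delta>: "0 < \<delta>" "\<delta> < \<eta>" for y s \<delta>
  proof (rule ccontr)
    assume neg: "\<not> ?thesis"
    define \<nu> where "\<nu> = u (y + \<delta> *\<^sub>R q) (s + \<delta>) - \<delta> * c - u y s"
    have \<nu>: "\<nu> > 0" using neg unfolding \<nu>_def by simp
    \<comment> \<open>The first bound keeps the loss \<open>\<gamma> * D\<^sup>2 / 2\<close> at the
      initial time below the violation \<nu>; the second keeps the maximum point within
      \<open>\<rho>1 / 4\<close> of the segment, hence inside the ball.\<close>
    define \<gamma> where "\<gamma> = min (\<nu> / (D\<^sup>2 + 1)) (\<rho>1 / (8 * (D + 1)))"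
    have D2: "D\<^sup>2 + 1 > 0" by (simp add: add_nonneg_pos)
    have \<gamma>: "\<gamma> > 0" using \<nu> \<rho>1 D D2 unfolding \<gamma>_def by auto
    have "\<gamma> * (D\<^sup>2 + 1) \<le> \<nu>" using D2 unfolding \<gamma>_def by (simp add: min_le_iff_disj flip: pos_le_divide_eq)
    then have \<gamma>1: "\<gamma> * D\<^sup>2 / 2 < \<nu>" using \<gamma> \<nu> by (simp add: algebra_simps)
    have "\<gamma> * (8 * (D + 1)) \<le> \<rho>1" using D unfolding \<gamma>_def by (simp add: min_le_iff_disj flip: pos_le_divide_eq)
    then have \<gamma>2: "2 * \<gamma> * D \<le> \<rho>1 / 4" using \<gamma> by (simp add: algebra_simps)
    have "compact ((\<lambda>(x, t). u x t) ` (cball y0 1 \<times> {0..\<tau>}))"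
      by (intro compact_continuous_image cu compact_Times compact_cball compact_Icc)
    then obtain M where M: "\<And>x t. x \<in> cball y0 1 \<Longrightarrow> t \<in> {0..\<tau>} \<Longrightarrow> \<bar>u x t\<bar> \<le> M"
      by (force dest!: compact_imp_bounded simp: bounded_iff)
    have M0: "M \<ge> 0" using M[of y0 0] \<tau> by auto
    \<comment> \<open>At \<open>s + 2 * \<delta>\<close> the late-time penalty amounts to
      \<open>N * \<delta>\<^sup>2\<close>, which outweighs the oscillation of \<open>u\<close> and
      the drift \<open>c\<close>, so no maximum lies there.\<close>
    define N where "N = (2 * M + 3 * \<bar>c\<bar> * \<delta> + 1) / \<delta>\<^sup>2"
    have N: "N \<ge> 0" "N * \<delta>\<^sup>2 = 2 * M + 3 * \<bar>c\<bar> * \<delta> + 1" using M0 \<delta> unfolding N_def by auto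
    have time: "0 < t \<and> t < \<tau> \<and> \<bar>t - s0\<bar> < \<rho>1" if "t \<in> {s..s + 2 * \<delta>}" for t
    proof -
      have "\<bar>t - s0\<bar> < 3 * \<eta>" using that s \<delta> by auto
      also have "\<dots> \<le> \<rho>1" using \<eta>q \<open>\<eta> * norm q \<ge> 0\<close> \<rho>1(1) by linarith
      finally have "\<bar>t - s0\<bar> < \<rho>1" .
      then show ?thesis using \<rho>1 by (auto simp: abs_less_iff)
    qed
    have path: "norm (y + (t - s) *\<^sub>R q - y0) \<le> \<rho>1 / 3" if "t \<in> {s..s + 2 * \<delta>}" for t
    proof -
      have "norm (y + (t - s) *\<^sub>R q - y0) \<le> norm (y - y0) + norm ((t - s) *\<^sub>R q)"
        using norm_triangle_ineq[of "y - y0" "(t - s) *\<^sub>R q"] by (simp add: algebra_simps)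
      also have "norm ((t - s) *\<^sub>R q) \<le> (2 * \<eta>) * norm q"
        using that \<delta> by (auto intro!: mult_right_mono)
      finally show ?thesis using y \<eta>q \<open>\<eta> > 0\<close> by (simp add: algebra_simps)
    qed
    \<comment> \<open>The violation occurs at \<open>s + \<delta>\<close>, so the interval is
      prolonged to \<open>s + 2 * \<delta>\<close> to make that time interior. The added penalty has
      nonnegative time derivative and can only help in the subsolution test.\<close>
    define h where "h t = c * (t - s) + N * (max 0 (t - s - \<delta>))\<^sup>2" for t
    define \<phi> where "\<phi> z = h (snd z) + 1 / (2 * \<gamma>) * (norm (fst z - (y - s *\<^sub>R q) - snd z *\<^sub>R q))\<^sup>2"
      for z :: "'a \<times> real"
    have dh: "(h has_real_derivative c + N * (2 * max 0 (t - s - \<delta>))) (at t)" for t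
    proof -
      have "((\<lambda>t. (max 0 (t - s - \<delta>))\<^sup>2) has_real_derivative 2 * max 0 (t - s - \<delta>) * 1) (at t)"
        by (rule DERIV_chain2[OF max0_square_has_derivative]) (auto intro!: derivative_eq_intros)
      from DERIV_add[OF DERIV_cmult[OF DERIV_diff[OF DERIV_ident DERIV_const]] DERIV_cmult[OF this]]
      show ?thesis unfolding h_def[abs_def] by simp
    qed
    have dg: "((\<lambda>t. 1 / (2 * \<gamma>)) has_real_derivative 0) (at t)" for t by simp
    have C\<phi>: "C1_xt UNIV \<phi> (\<lambda>z. (1 / \<gamma>) *\<^sub>R (fst z - (y - s *\<^sub>R q) - snd z *\<^sub>R q))
        (\<lambda>z. c + N * (2 * max 0 (snd z - s - \<delta>)) - (1 / \<gamma>) * ((fst z - (y - s *\<^sub>R q) - snd z *\<^sub>R q) \<bullet> q))"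
    proof -
      have "C1_xt UNIV (\<lambda>z::'a \<times> real. h (snd z)) (\<lambda>z. 0) (\<lambda>z. c + N * (2 * max 0 (snd z - s - \<delta>)))"
        by (intro C1_xt_time dh continuous_intros)
      from C1_xt_add[OF this C1_xt_mult[OF C1_xt_time[OF dg continuous_on_const] C1_xt_norm_square[of "y - s *\<^sub>R q" q]]]
      show ?thesis unfolding \<phi>_def by simp
    qed
    have \<phi>_path: "\<phi> (x, t) = h t + (norm (x - (y + (t - s) *\<^sub>R q)))\<^sup>2 / (2 * \<gamma>)" for x t
      unfolding \<phi>_def by (simp add: algebra_simps)
    define S where "S = cball y0 \<rho>1 \<times> {s..s + 2 * \<delta>}"
    have S1: "(y + (t - s) *\<^sub>R q, t) \<in> S" if "t \<in> {s..s + 2 * \<delta>}" for t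
      using path[OF that] that \<rho>1 unfolding S_def by (auto simp: dist_norm norm_minus_commute)
    have Sin: "x \<in> cball y0 1 \<and> t \<in> {0..\<tau>}" if "(x, t) \<in> S" for x t
      using time[of t] that \<rho>1 unfolding S_def by auto
    have "continuous_on S (\<lambda>z. u (fst z) (snd z) - \<phi> z)"
    proof (intro continuous_intros)
      show "continuous_on S (\<lambda>z. u (fst z) (snd z))"
        by (rule continuous_on_subset[OF cu[unfolded case_prod_unfold]]) (use Sin in auto)
      show "continuous_on S \<phi>"
        using C1_xt_imp_continuous_on[OF C\<phi>] continuous_on_subset by blast
    qed
    moreover have "compact S" unfolding S_def by (intro compact_Times compact_cball compact_Icc)
    moreover have "S \<noteq> {}" using S1[of s] \<delta> by auto
    ultimately obtain z where z: "z \<in> S" "\<And>w. w \<in> S \<Longrightarrow> u (fst w) (snd w) - \<phi> w \<le> u (fst z) (snd z) - \<phi> z"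
      using continuous_attains_sup[of S "\<lambda>z. u (fst z) (snd z) - \<phi> z"] by blast
    obtain X t where zXt: "z = (X, t)" by force
    have XtS: "(X, t) \<in> S" using z zXt by simp
    have t: "t \<in> {s..s + 2 * \<delta>}" using XtS unfolding S_def by auto
    have max: "u x t' - \<phi> (x, t') \<le> u X t - \<phi> (X, t)" if "(x, t') \<in> S" for x t'
      using z(2)[OF that] zXt by simp
    have val: "u X t - \<phi> (X, t) \<ge> u y s + \<nu>"
      using max[OF S1[of "s + \<delta>"]] \<delta> unfolding \<phi>_path h_def \<nu>_def by (simp add: algebra_simps)
    define d where "d = norm (X - (y + (t - s) *\<^sub>R q))"
    have lip: "u X t - u (y + (t - s) *\<^sub>R q) t \<le> D * d"
      using D(2)[of X "y + (t - s) *\<^sub>R q" t] Sin[OF XtS] Sin[OF S1[OF t]] unfolding d_def by auto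
    \<comment> \<open>The comparison point is the one on the segment at the same time, so that only
      the spatial Lipschitz bound is needed.\<close>
    have dd: "d\<^sup>2 / (2 * \<gamma>) \<le> D * d"
      using max[OF S1[OF t]] lip unfolding \<phi>_path d_def by simp
    have d_le: "d \<le> 2 * \<gamma> * D"
    proof (cases "d = 0")
      case False
      then have "d > 0" unfolding d_def by simp
      then show ?thesis using dd \<gamma> by (simp add: power2_eq_square field_simps)
    qed (use \<gamma> D in simp)
    have Xball: "norm (X - y0) < \<rho>1"
      using norm_triangle_ineq[of "X - (y + (t - s) *\<^sub>R q)" "y + (t - s) *\<^sub>R q - y0"] path[OF t] d_le \<gamma>2 \<rho>1(1)
      unfolding d_def by simp
    have "t \<noteq> s"
    proof
      assume "t = s"
      have "u X s - u y s \<le> D * d" using lip \<open>t = s\<close> by simp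
      moreover have "D * d \<le> \<gamma> * D\<^sup>2 / 2 + d\<^sup>2 / (2 * \<gamma>)"
      proof -
        have "0 \<le> (d - \<gamma> * D)\<^sup>2 / (2 * \<gamma>)" using \<gamma> by simp
        also have "\<dots> = \<gamma> * D\<^sup>2 / 2 + d\<^sup>2 / (2 * \<gamma>) - D * d"
          using \<gamma> by (simp add: field_simps power2_eq_square)
        finally show ?thesis by simp
      qed
      moreover have "\<phi> (X, t) = d\<^sup>2 / (2 * \<gamma>)" unfolding \<phi>_path h_def d_def using \<open>t = s\<close> \<delta> by simp
      ultimately show False using val \<gamma>1 \<open>t = s\<close> by simp
    qed
    moreover have "t \<noteq> s + 2 * \<delta>"
    proof
      assume ts: "t = s + 2 * \<delta>"
      have "(norm (X - (y + (t - s) *\<^sub>R q)))\<^sup>2 / (2 * \<gamma>) \<ge> 0" using \<gamma> by simp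
      moreover have "u X t \<le> M" using M[of X t] Sin[OF XtS] by auto
      moreover have "h t = c * (2 * \<delta>) + N * \<delta>\<^sup>2" using \<delta> unfolding h_def ts by simp
      ultimately have "u X t - \<phi> (X, t) \<le> M - c * (2 * \<delta>) - N * \<delta>\<^sup>2"
        unfolding \<phi>_path by linarith
      moreover have "u (y + \<delta> *\<^sub>R q) (s + \<delta>) - c * \<delta> \<ge> - M - c * \<delta>"
        using M[of "y + \<delta> *\<^sub>R q" "s + \<delta>"] Sin[OF S1[of "s + \<delta>"]] \<delta> by auto
      moreover have "N * \<delta>\<^sup>2 = 2 * M + 3 * \<bar>c * \<delta>\<bar> + 1" using N(2) \<delta> by (simp add: abs_mult)
      moreover have "u X t - \<phi> (X, t) \<ge> u (y + \<delta> *\<^sub>R q) (s + \<delta>) - c * \<delta>"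
        using val unfolding \<nu>_def by (simp add: mult.commute)
      ultimately show False by linarith
    qed
    ultimately have t': "s < t" "t < s + 2 * \<delta>" using t by auto
    define p where "p = (1 / \<gamma>) *\<^sub>R (X - (y + (t - s) *\<^sub>R q))"
    have "norm p = d / \<gamma>" unfolding p_def d_def using \<gamma> by simp
    then have p: "norm p \<le> 2 * D" using d_le \<gamma> by (simp add: pos_divide_le_eq mult_ac)
    have shift: "X - (y - s *\<^sub>R q) - t *\<^sub>R q = X - (y + (t - s) *\<^sub>R q)" by (simp add: algebra_simps)
    have "c + N * (2 * max 0 (t - s - \<delta>)) - (1 / \<gamma>) * ((X - (y - s *\<^sub>R q) - t *\<^sub>R q) \<bullet> q)
        + H X t (u X t) ((1 / \<gamma>) *\<^sub>R (X - (y - s *\<^sub>R q) - t *\<^sub>R q)) \<le> 0"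
      using visc_sub_atD[OF viscosity_solution_imp_sub_super(1)[OF sol] C\<phi>,
          where x = X and t = t and S = "ball y0 \<rho>1 \<times> {s<..<s + 2 * \<delta>}"] time[OF t] \<tau> Xball t' max
      unfolding S_def by (auto simp: open_Times dist_norm norm_minus_commute)
    moreover have "(1 / \<gamma>) * ((X - (y - s *\<^sub>R q) - t *\<^sub>R q) \<bullet> q) = q \<bullet> p"
      unfolding shift p_def by (simp add: inner_commute)
    ultimately have "c + N * (2 * max 0 (t - s - \<delta>)) - q \<bullet> p + H X t (u X t) p \<le> 0"
      unfolding shift p_def[symmetric] by linarith
    moreover have "N * (2 * max 0 (t - s - \<delta>)) \<ge> 0" using N by simp
    moreover have "H X t (u X t) p > H0 + q \<bullet> (p - p0) - e / 2"
      using lower[OF Xball _ p] time[OF t] by simp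
    \<comment> \<open>The minorant loses at most \<open>e / 2\<close> near the base point while
      \<open>c\<close> contains the full \<open>e\<close>, so the left-hand side exceeds
      \<open>e / 2\<close>. The slope \<open>p\<close> has disappeared, because the penalty moves
      with velocity \<open>q\<close>.\<close>
    ultimately show False using e unfolding c_def by (simp add: inner_diff_right)
  qed
  then show thesis using that[OF \<eta>(1)] unfolding c_def H0_def by blast
qed

end

subsection \<open>The inf-convolution\<close>

lemma continuous_on_Inf_compact:
  fixes f :: "'a::metric_space \<Rightarrow> 'b::metric_space \<Rightarrow> real"
  assumes S: "compact S" and C: "compact C" "C \<noteq> {}"
    and f: "continuous_on (S \<times> C) (\<lambda>(z, y). f z y)"
  shows "continuous_on S (\<lambda>z. Inf (f z ` C))"
  unfolding continuous_on_iff
proof (intro ballI allI impI)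
  have uc: "uniformly_continuous_on (S \<times> C) (\<lambda>(z, y). f z y)"
    by (intro compact_uniformly_continuous f compact_Times S C)
  have bdd: "bdd_below (f z ` C)" if "z \<in> S" for z
  proof -
    have "continuous_on C (f z)"
    proof -
      have "continuous_on C (\<lambda>y. case (z, y) of (z, y) \<Rightarrow> f z y)"
        by (rule continuous_on_compose2[OF f]) (use that in \<open>auto intro!: continuous_intros\<close>)
      then show ?thesis by simp
    qed
    then have "compact (f z ` C)" by (rule compact_continuous_image[OF _ C(1)])
    then show ?thesis by (intro bounded_imp_bdd_below compact_imp_bounded)
  qed
  fix z and e :: real assume z: "z \<in> S" and "0 < e"
  then have e2: "0 < e / 2" by simp
  obtain d where d: "d > 0" "\<And>v w. v \<in> S \<times> C \<Longrightarrow> w \<in> S \<times> C \<Longrightarrow> dist w v < d \<Longrightarrow>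
      dist ((\<lambda>(z, y). f z y) w) ((\<lambda>(z, y). f z y) v) < e / 2"
    using uc[unfolded uniformly_continuous_on_def, THEN spec, THEN mp, OF e2] by blast
  have le: "Inf (f v ` C) \<le> Inf (f w ` C) + e / 2" if "v \<in> S" "w \<in> S" "dist v w < d" for v w
  proof -
    have "Inf (f v ` C) - e / 2 \<le> Inf (f w ` C)"
    proof (rule cINF_greatest[OF C(2)])
      fix y assume "y \<in> C"
      then have "dist (f v y) (f w y) < e / 2"
        using d(2)[of "(w, y)" "(v, y)"] that by (simp add: dist_Pair_Pair)
      moreover have "Inf (f v ` C) \<le> f v y" using \<open>y \<in> C\<close> bdd[OF that(1)] by (rule cINF_lower[rotated])
      ultimately show "Inf (f v ` C) - e / 2 \<le> f w y" unfolding dist_real_def by linarith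
    qed
    then show ?thesis by simp
  qed
  show "\<exists>d>0. \<forall>x'\<in>S. dist x' z < d \<longrightarrow> dist (Inf (f x' ` C)) (Inf (f z ` C)) < e"
  proof (intro exI conjI ballI impI)
    show "d > 0" by (rule d)
    fix x' assume "x' \<in> S" "dist x' z < d"
    then show "dist (Inf (f x' ` C)) (Inf (f z ` C)) < e"
      using le[of x' z] le[of z x'] z e2 unfolding dist_real_def by (simp add: dist_commute)
  qed
qed

context hamilton_jacobi
begin

text \<open>The decay rate of the weight is chosen so that, in the equation of the inf-convolution,
  the errors of (H1) and (H3), which are quadratic in \<open>x - y\<close>, are absorbed.\<close>

definition decay :: real where "decay = K3 + 2 * C1 + C1 * \<beta> / 2"

definition weight :: "real \<Rightarrow> real \<Rightarrow> real" where "weight \<epsilon> t = exp (- decay * t) / (2 * \<epsilon>)"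

text \<open>The infimum is taken over a ball, so that minimizers exist without any control of
  \<open>u\<close> at infinity. For small \<epsilon> they are interior when \<open>x\<close> is well
  inside the ball.\<close>

definition inf_conv :: "real \<Rightarrow> 'a \<Rightarrow> real \<Rightarrow> 'a \<Rightarrow> real \<Rightarrow> real" where
  "inf_conv \<epsilon> a R x t = Inf ((\<lambda>y. u y t + weight \<epsilon> t * (norm (x - y))\<^sup>2) ` cball a R)"

lemma decay_nonneg: "decay \<ge> 0"
  using H1(1,2) H3(1) unfolding decay_def by auto

lemma weight_pos: "\<epsilon> > 0 \<Longrightarrow> weight \<epsilon> t > 0"
  unfolding weight_def by simp

lemma weight_has_derivative: "(weight \<epsilon> has_real_derivative - decay * weight \<epsilon> t) (at t)"
  unfolding weight_def[abs_def] by (cases "\<epsilon> = 0") (auto intro!: derivative_eq_intros)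

lemma inf_conv_attained:
  assumes "R \<ge> 0" "t \<in> {0..<T}"
  obtains y where "y \<in> cball a R" "inf_conv \<epsilon> a R x t = u y t + weight \<epsilon> t * (norm (x - y))\<^sup>2"
    "\<And>y'. y' \<in> cball a R \<Longrightarrow> inf_conv \<epsilon> a R x t \<le> u y' t + weight \<epsilon> t * (norm (x - y'))\<^sup>2"
proof -
  let ?f = "\<lambda>y. u y t + weight \<epsilon> t * (norm (x - y))\<^sup>2"
  have "continuous_on (cball a R) (\<lambda>y. case (y, t) of (x, t) \<Rightarrow> u x t)"
    by (rule continuous_on_compose2[OF u_cont]) (use assms(2) in \<open>auto intro!: continuous_intros\<close>)
  then have "continuous_on (cball a R) ?f"
    by (auto intro!: continuous_intros)
  then obtain y where y: "y \<in> cball a R" "\<And>y'. y' \<in> cball a R \<Longrightarrow> ?f y \<le> ?f y'"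
    using continuous_attains_inf[of "cball a R" ?f] assms(1) by auto
  then have "inf_conv \<epsilon> a R x t = ?f y"
    unfolding inf_conv_def by (intro cInf_eq_minimum) auto
  then show thesis using that y by metis
qed

lemma inf_conv_continuous:
  assumes "R \<ge> 0" "\<tau> < T" "\<epsilon> > 0"
  shows "continuous_on (cball b R' \<times> {0..\<tau>}) (\<lambda>(x, t). inf_conv \<epsilon> a R x t)"
proof -
  have cw: "continuous_on UNIV (weight \<epsilon>)"
    using weight_has_derivative by (meson DERIV_continuous_on has_field_derivative_at_within)
  have "continuous_on (cball b R' \<times> {0..\<tau>})
      (\<lambda>z. Inf ((\<lambda>y. u y (snd z) + weight \<epsilon> (snd z) * (norm (fst z - y))\<^sup>2) ` cball a R))"
  proof (rule continuous_on_Inf_compact)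
    have "continuous_on ((cball b R' \<times> {0..\<tau>}) \<times> cball a R) (\<lambda>z. case (snd z, snd (fst z)) of (x, t) \<Rightarrow> u x t)"
      by (rule continuous_on_compose2[OF u_cont]) (use assms(2) in \<open>auto intro!: continuous_intros\<close>)
    then have "continuous_on ((cball b R' \<times> {0..\<tau>}) \<times> cball a R) (\<lambda>z. u (snd z) (snd (fst z)))"
      by simp
    then show "continuous_on ((cball b R' \<times> {0..\<tau>}) \<times> cball a R)
      (\<lambda>(z, y). u y (snd z) + weight \<epsilon> (snd z) * (norm (fst z - y))\<^sup>2)"
      unfolding case_prod_unfold by (intro continuous_intros continuous_on_compose2[OF cw]) auto
  qed (use assms in \<open>auto intro!: compact_Times\<close>)
  then show ?thesis unfolding inf_conv_def by (simp add: case_prod_unfold)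
qed

text \<open>The penalty paid, \<open>weight \<epsilon> t * d\<^sup>2\<close>, cannot exceed the gain
  \<open>D * d\<close> in \<open>u\<close>, so \<open>d \<le> D / weight \<epsilon> t\<close>, which
  is of order \<epsilon>.\<close>

lemma inf_conv_minimizer_close:
  assumes \<epsilon>: "\<epsilon> > 0" and t: "t \<in> {0..\<tau>}"
    and lip: "\<bar>u x t - u y t\<bar> \<le> D * norm (x - y)" and D: "D \<ge> 0"
    and min: "u y t + weight \<epsilon> t * (norm (x - y))\<^sup>2 \<le> u x t"
  shows "norm (x - y) \<le> 2 * \<epsilon> * D * exp (decay * \<tau>)"
proof -
  let ?d = "norm (x - y)"
  have "weight \<epsilon> t * ?d\<^sup>2 \<le> D * ?d" using lip min by linarith
  then have "weight \<epsilon> t * ?d \<le> D"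
    using D by (cases "?d = 0") (auto simp: power2_eq_square)
  then have "?d \<le> D / weight \<epsilon> t" using weight_pos[OF \<epsilon>] by (simp add: pos_le_divide_eq mult.commute)
  also have "\<dots> = 2 * \<epsilon> * D * exp (decay * t)" unfolding weight_def by (simp add: exp_minus field_simps)
  also have "\<dots> \<le> 2 * \<epsilon> * D * exp (decay * \<tau>)"
    using t \<epsilon> D decay_nonneg by (intro mult_left_mono) (auto simp: mult_left_mono)
  finally show ?thesis .
qed

text \<open>An infimum is bounded above by a competitor. The minimizer \<open>y\<close> for the
  earlier point \<open>x - \<delta> *\<^sub>R q\<close> is carried to
  \<open>y + \<delta> *\<^sub>R q'\<close> by the transport inequality and inserted at
  \<open>(x, t)\<close>. Here \<open>q\<close> is a subgradient of \<open>H\<close> at the test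
  gradient \<open>p\<close>, and \<open>q'\<close> one at the penalty gradient \<open>P\<close> at
  the limit minimizer. As \<delta> tends to 0, \<open>q'\<close> cancels; the subgradient inequality
  for \<open>q\<close> then replaces \<open>P\<close> by \<open>p\<close>, and (H1) and (H3) are
  paid for by the decay of the weight.\<close>

lemma inf_conv_visc_sub:
  assumes \<epsilon>: "\<epsilon> > 0" and \<tau>: "\<tau> < T" and D: "D \<ge> 0"
    and lip: "\<And>x y t. x \<in> cball a R \<Longrightarrow> y \<in> cball a R \<Longrightarrow> t \<in> {0..\<tau>} \<Longrightarrow> \<bar>u x t - u y t\<bar> \<le> D * norm (x - y)"
    and small: "R' + 2 * \<epsilon> * D * exp (decay * \<tau>) < R"
    and x: "x \<in> ball a R'" and t: "0 < t" "t < \<tau>"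
  shows "visc_sub_at (\<lambda>x t v p. H x t v p - C1 * \<beta> * \<epsilon> * exp (decay * t)) (inf_conv \<epsilon> a R) x t"
  unfolding visc_sub_at_def
proof (intro allI impI)
  fix \<psi> :: "'a \<times> real \<Rightarrow> real" and Dx Dt
  assume \<psi>: "C1_xt UNIV \<psi> Dx Dt"
    and touch: "\<forall>\<^sub>F (y, s) in nhds (x, t). inf_conv \<epsilon> a R y s - \<psi> (y, s) \<le> inf_conv \<epsilon> a R x t - \<psi> (x, t)"
  define w where "w = inf_conv \<epsilon> a R"
  define k where "k = weight \<epsilon>"
  define p where "p = Dx (x, t)"
  have tT: "t \<in> {0..T}" using t \<tau> by auto
  have expo: "2 * \<epsilon> * D * exp (decay * \<tau>) \<ge> 0" using \<epsilon> D by simp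
  have R: "R \<ge> 0" "x \<in> cball a R"
    using x expo small zero_le_dist[of a x] unfolding mem_ball mem_cball by linarith+
  obtain q where q: "\<And>p'. H x t (w x t) p' \<ge> H x t (w x t) p + q \<bullet> (p' - p)"
    using convex_on_subgradient[OF H4[OF tT]] by metis
  \<comment> \<open>The offset 2 keeps even the step for \<open>n = 0\<close> strictly below
    \<open>t\<close>, so that the earlier time is positive.\<close>
  define \<delta> where "\<delta> n = t / real (n + 2)" for n :: nat
  have \<delta>: "0 < \<delta> n" "\<delta> n < t" for n using t unfolding \<delta>_def by (auto simp: divide_less_eq)
  have \<delta>0: "\<delta> \<longlonglongrightarrow> 0"
    unfolding \<delta>_def using LIMSEQ_ignore_initial_segment[OF lim_const_over_n[of t], of 2] by simp
  have "\<forall>n. \<exists>y. y \<in> cball a R \<and> w (x - \<delta> n *\<^sub>R q) (t - \<delta> n)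
        = u y (t - \<delta> n) + k (t - \<delta> n) * (norm (x - \<delta> n *\<^sub>R q - y))\<^sup>2 \<and>
      (\<forall>y'\<in>cball a R. w (x - \<delta> n *\<^sub>R q) (t - \<delta> n)
        \<le> u y' (t - \<delta> n) + k (t - \<delta> n) * (norm (x - \<delta> n *\<^sub>R q - y'))\<^sup>2)"
  proof
    fix n
    have "t - \<delta> n \<in> {0..<T}" using \<delta>[of n] t \<tau> by auto
    from inf_conv_attained[OF R(1) this, of a \<epsilon> "x - \<delta> n *\<^sub>R q"]
    show "\<exists>y. y \<in> cball a R \<and> w (x - \<delta> n *\<^sub>R q) (t - \<delta> n)
        = u y (t - \<delta> n) + k (t - \<delta> n) * (norm (x - \<delta> n *\<^sub>R q - y))\<^sup>2 \<and>
      (\<forall>y'\<in>cball a R. w (x - \<delta> n *\<^sub>R q) (t - \<delta> n)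
        \<le> u y' (t - \<delta> n) + k (t - \<delta> n) * (norm (x - \<delta> n *\<^sub>R q - y'))\<^sup>2)"
      unfolding w_def k_def by metis
  qed
  then obtain y0 where y0: "\<forall>n. y0 n \<in> cball a R \<and> w (x - \<delta> n *\<^sub>R q) (t - \<delta> n)
        = u (y0 n) (t - \<delta> n) + k (t - \<delta> n) * (norm (x - \<delta> n *\<^sub>R q - y0 n))\<^sup>2 \<and>
      (\<forall>y'\<in>cball a R. w (x - \<delta> n *\<^sub>R q) (t - \<delta> n)
        \<le> u y' (t - \<delta> n) + k (t - \<delta> n) * (norm (x - \<delta> n *\<^sub>R q - y'))\<^sup>2)"
    by (rule choice[THEN exE])
  obtain Y r where Y: "Y \<in> cball a R" "strict_mono r" "(y0 \<circ> r) \<longlonglongrightarrow> Y"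
    using y0 compact_cball[of a R] unfolding compact_def by meson
  define y where "y n = y0 (r n)" for n
  define d where "d n = \<delta> (r n)" for n
  have y: "y n \<in> cball a R" and wy: "w (x - d n *\<^sub>R q) (t - d n)
        = u (y n) (t - d n) + k (t - d n) * (norm (x - d n *\<^sub>R q - y n))\<^sup>2"
    and wle: "\<And>y'. y' \<in> cball a R \<Longrightarrow> w (x - d n *\<^sub>R q) (t - d n)
        \<le> u y' (t - d n) + k (t - d n) * (norm (x - d n *\<^sub>R q - y'))\<^sup>2" for n
    using y0[rule_format, of "r n"] unfolding y_def d_def by blast+
  have yY: "y \<longlonglongrightarrow> Y" using Y(3) unfolding y_def by (simp add: o_def)
  have d: "0 < d n" "d n < t" for n using \<delta> unfolding d_def by auto
  have d0: "d \<longlonglongrightarrow> 0" using LIMSEQ_subseq_LIMSEQ[OF \<delta>0 Y(2)] unfolding d_def by (simp add: o_def)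
  have ck: "isCont k s" for s
    unfolding k_def using weight_has_derivative by (rule DERIV_isCont)
  have lim_t: "(\<lambda>n. t - d n) \<longlonglongrightarrow> t" using tendsto_diff[OF tendsto_const d0] by simp
  have lim_x: "(\<lambda>n. x - d n *\<^sub>R q) \<longlonglongrightarrow> x"
    using tendsto_diff[OF tendsto_const tendsto_scaleR[OF d0 tendsto_const]] by simp
  have lim_k: "(\<lambda>n. k (t - d n)) \<longlonglongrightarrow> k t" using isCont_tendsto_compose[OF ck lim_t] .
  have lim_u: "(\<lambda>n. u (v n) (t - d n)) \<longlonglongrightarrow> u V t" if "v \<longlonglongrightarrow> V" for v V
  proof -
    have "\<forall>\<^sub>F n in sequentially. (v n, t - d n) \<in> UNIV \<times> {0..<T}"
    proof (intro always_eventually allI)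
      show "(v n, t - d n) \<in> UNIV \<times> {0..<T}" for n using d[of n] t \<tau> by auto
    qed
    from continuous_on_tendsto_compose[OF u_cont tendsto_Pair[OF that lim_t] _ this]
    show ?thesis using t \<tau> by simp
  qed
  have min: "u Y t + k t * (norm (x - Y))\<^sup>2 \<le> u y' t + k t * (norm (x - y'))\<^sup>2" if "y' \<in> cball a R" for y'
  proof (rule LIMSEQ_le)
    show "(\<lambda>n. u (y n) (t - d n) + k (t - d n) * (norm (x - d n *\<^sub>R q - y n))\<^sup>2)
        \<longlonglongrightarrow> u Y t + k t * (norm (x - Y))\<^sup>2"
      by (intro tendsto_intros lim_u lim_k lim_x yY)
    show "(\<lambda>n. u y' (t - d n) + k (t - d n) * (norm (x - d n *\<^sub>R q - y'))\<^sup>2)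
        \<longlonglongrightarrow> u y' t + k t * (norm (x - y'))\<^sup>2"
      by (intro tendsto_intros lim_u lim_k lim_x)
    show "\<exists>N. \<forall>n\<ge>N. u (y n) (t - d n) + k (t - d n) * (norm (x - d n *\<^sub>R q - y n))\<^sup>2
        \<le> u y' (t - d n) + k (t - d n) * (norm (x - d n *\<^sub>R q - y'))\<^sup>2"
      using wle[OF that] wy by auto
  qed
  have wxt: "w x t = u Y t + k t * (norm (x - Y))\<^sup>2"
    unfolding w_def inf_conv_def k_def[symmetric] by (intro cInf_eq_minimum) (use min Y in auto)
  have w_le: "w x t \<le> u y' t + k t * (norm (x - y'))\<^sup>2" if "y' \<in> cball a R" for y'
    using min[OF that] wxt by simp
  have "norm (x - Y) \<le> 2 * \<epsilon> * D * exp (decay * \<tau>)"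
    by (rule inf_conv_minimizer_close[OF \<epsilon> _ lip D])
      (use R Y t min[OF R(2)] in \<open>auto simp: k_def\<close>)
  \<comment> \<open>Having \<open>Y\<close> interior makes the transported points admissible
    competitors from some index on.\<close>
  then have Yball: "Y \<in> ball a R"
    using dist_triangle[of a Y x] x small unfolding mem_ball dist_norm by (simp add: norm_minus_commute)
  define P where "P = (2 * k t) *\<^sub>R (x - Y)"
  obtain q' where q': "\<And>p'. H Y t (u Y t) p' \<ge> H Y t (u Y t) P + q' \<bullet> (p' - P)"
    using convex_on_subgradient[OF H4[OF tT]] by metis
  define H0 where "H0 = H Y t (u Y t) P"
  have tT': "t < T" using t \<tau> by simp
  have key: "Dt (x, t) + q \<bullet> p \<le> q \<bullet> P - H0 - decay * k t * (norm (x - Y))\<^sup>2 + e" if e: "e > 0" for e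
  proof -
    obtain \<eta> where \<eta>: "\<eta> > 0"
      "\<And>y s \<delta>. norm (y - Y) < \<eta> \<Longrightarrow> \<bar>s - t\<bar> < \<eta> \<Longrightarrow> 0 < \<delta> \<Longrightarrow> \<delta> < \<eta> \<Longrightarrow>
         u (y + \<delta> *\<^sub>R q') (s + \<delta>) \<le> u y s + \<delta> * (q' \<bullet> P - H0 + e)"
      using u_transport[OF t(1) tT' e q'] unfolding H0_def by metis
    have lim_z: "(\<lambda>n. y n + d n *\<^sub>R q') \<longlonglongrightarrow> Y"
      using tendsto_add[OF yY tendsto_scaleR[OF d0 tendsto_const]] by simp
    have ev1: "\<forall>\<^sub>F n in sequentially. y n + d n *\<^sub>R q' \<in> ball a R"
      by (rule topological_tendstoD[OF lim_z _ Yball]) simp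
    have ev2: "\<forall>\<^sub>F n in sequentially. norm (y n - Y) < \<eta>"
      using tendstoD[OF yY \<eta>(1)] by (simp add: dist_norm)
    have ev3: "\<forall>\<^sub>F n in sequentially. d n < \<eta>"
      using order_tendstoD(2)[OF d0 \<eta>(1)] .
    have ev4: "\<forall>\<^sub>F n in sequentially. w (x - d n *\<^sub>R q) (t - d n) - \<psi> (x - d n *\<^sub>R q, t - d n) \<le> w x t - \<psi> (x, t)"
      using eventually_compose_filterlim[OF touch tendsto_Pair[OF lim_x lim_t]] unfolding w_def by simp
    define A where "A n = (\<psi> (x, t) - \<psi> (x - d n *\<^sub>R q, t - d n)) / d n" for n
    define B where "B n = (q' \<bullet> P - H0 + e) + k t * (2 * ((x - y n) \<bullet> (q - q')) + d n * ((norm q')\<^sup>2 - (norm q)\<^sup>2))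
        + (k t - k (t - d n)) / d n * (norm (x - y n - d n *\<^sub>R q))\<^sup>2" for n
    have AB: "\<forall>\<^sub>F n in sequentially. A n \<le> B n"
      using ev1 ev2 ev3 ev4
    proof eventually_elim
      case (elim n)
      have expand: "(norm (b - c *\<^sub>R q'))\<^sup>2 - (norm (b - c *\<^sub>R q))\<^sup>2
          = c * (2 * (b \<bullet> (q - q')) + c * ((norm q')\<^sup>2 - (norm q)\<^sup>2))" for b c
        unfolding power2_norm_eq_inner
        by (simp add: inner_diff_left inner_diff_right inner_commute algebra_simps)
      have "u (y n + d n *\<^sub>R q') (t - d n + d n) \<le> u (y n) (t - d n) + d n * (q' \<bullet> P - H0 + e)"
        using elim d[of n] by (intro \<eta>(2)) auto
      then have tr: "u (y n + d n *\<^sub>R q') t \<le> u (y n) (t - d n) + d n * (q' \<bullet> P - H0 + e)" by simp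
      have "w x t \<le> u (y n + d n *\<^sub>R q') t + k t * (norm (x - (y n + d n *\<^sub>R q')))\<^sup>2"
        using elim by (intro w_le) auto
      also have "x - (y n + d n *\<^sub>R q') = (x - y n) - d n *\<^sub>R q'" by simp
      finally have 1: "w x t \<le> u (y n + d n *\<^sub>R q') t + k t * (norm ((x - y n) - d n *\<^sub>R q'))\<^sup>2" .
      have 2: "w (x - d n *\<^sub>R q) (t - d n) = u (y n) (t - d n) + k (t - d n) * (norm (x - y n - d n *\<^sub>R q))\<^sup>2"
        unfolding wy by (simp add: algebra_simps)
      have "\<psi> (x, t) - \<psi> (x - d n *\<^sub>R q, t - d n) \<le> w x t - w (x - d n *\<^sub>R q) (t - d n)"
        using elim by linarith
      also have "\<dots> \<le> d n * (q' \<bullet> P - H0 + e) + k t * (norm ((x - y n) - d n *\<^sub>R q'))\<^sup>2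
          - k (t - d n) * (norm (x - y n - d n *\<^sub>R q))\<^sup>2"
        using 1 2 tr by linarith
      also have "\<dots> = d n * (q' \<bullet> P - H0 + e) + k t * ((norm ((x - y n) - d n *\<^sub>R q'))\<^sup>2 - (norm (x - y n - d n *\<^sub>R q))\<^sup>2)
          + (k t - k (t - d n)) * (norm (x - y n - d n *\<^sub>R q))\<^sup>2"
        by (simp add: algebra_simps)
      also have "\<dots> = d n * B n"
        unfolding expand B_def using d(1)[of n] by (simp add: distrib_left)
      finally show ?case unfolding A_def using d(1)[of n] by (simp add: pos_divide_le_eq mult.commute)
    qed
    have d_at: "filterlim d (at 0) sequentially"
      using d d0 by (intro filterlim_atI) (auto simp: less_imp_neq[symmetric])
    have limA: "A \<longlonglongrightarrow> q \<bullet> p + Dt (x, t)"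
    proof -
      have "((\<lambda>s. \<psi> (x - s *\<^sub>R q, t - s)) has_derivative (\<lambda>s. - (q \<bullet> p + Dt (x, t)) * s)) (at 0)"
      proof -
        have "((\<lambda>s. (x - s *\<^sub>R q, t - s)) has_derivative (\<lambda>s. (0 - s *\<^sub>R q, 0 - s))) (at 0)"
          by (intro derivative_intros)
        moreover have "(\<psi> has_derivative (\<lambda>(h, s). Dx (x, t) \<bullet> h + Dt (x, t) * s)) (at (x - 0 *\<^sub>R q, t - 0))"
          using \<psi> unfolding C1_xt_def by simp
        ultimately have "((\<lambda>s. \<psi> (x - s *\<^sub>R q, t - s)) has_derivative
            (\<lambda>s. (\<lambda>(h, s). Dx (x, t) \<bullet> h + Dt (x, t) * s) (0 - s *\<^sub>R q, 0 - s))) (at 0)"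
          by (rule has_derivative_compose)
        then show ?thesis by (simp add: p_def inner_commute algebra_simps)
      qed
      then have "((\<lambda>s. \<psi> (x - s *\<^sub>R q, t - s)) has_real_derivative - (q \<bullet> p + Dt (x, t))) (at 0)"
        by (simp add: has_field_derivative_def)
      then have "((\<lambda>s. (\<psi> (x - s *\<^sub>R q, t - s) - \<psi> (x, t)) / s) \<longlongrightarrow> - (q \<bullet> p + Dt (x, t))) (at 0)"
        by (simp add: has_field_derivative_iff)
      from tendsto_minus[OF filterlim_compose[OF this d_at]]
      show ?thesis unfolding A_def[abs_def] by (simp add: minus_divide_left add.commute)
    qed
    have limk': "(\<lambda>n. (k t - k (t - d n)) / d n) \<longlonglongrightarrow> - decay * k t"
    proof -
      have "((\<lambda>s. k (t - s)) has_real_derivative (- decay * k (t - 0)) * (- 1)) (at 0)"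
        unfolding k_def by (rule DERIV_chain2[OF weight_has_derivative]) (auto intro!: derivative_eq_intros)
      then have "((\<lambda>s. (k (t - s) - k t) / s) \<longlongrightarrow> decay * k t) (at 0)"
        by (simp add: has_field_derivative_iff)
      from tendsto_minus[OF filterlim_compose[OF this d_at]]
      show ?thesis by (simp add: minus_divide_left)
    qed
    have limB: "B \<longlonglongrightarrow> (q' \<bullet> P - H0 + e) + k t * (2 * ((x - Y) \<bullet> (q - q')) + 0 * ((norm q')\<^sup>2 - (norm q)\<^sup>2))
        + (- decay * k t) * (norm (x - Y - 0 *\<^sub>R q))\<^sup>2"
      unfolding B_def by (intro tendsto_intros yY d0 limk')
    have "q \<bullet> p + Dt (x, t) \<le> (q' \<bullet> P - H0 + e) + k t * (2 * ((x - Y) \<bullet> (q - q')) + 0 * ((norm q')\<^sup>2 - (norm q)\<^sup>2))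
        + (- decay * k t) * (norm (x - Y - 0 *\<^sub>R q))\<^sup>2"
      by (rule tendsto_le[OF _ limB limA AB]) simp
    \<comment> \<open>This is the first-order change of the penalty when its endpoints move with
      velocities \<open>q\<close> and \<open>q'\<close>; the part with \<open>q'\<close> cancels the
      one from the transport inequality.\<close>
    moreover have "k t * (2 * ((x - Y) \<bullet> (q - q'))) = q \<bullet> P - q' \<bullet> P"
      unfolding P_def by (simp add: inner_diff_right inner_diff_left inner_commute algebra_simps)
    ultimately show ?thesis by simp
  qed
  then have key': "Dt (x, t) + q \<bullet> p \<le> q \<bullet> P - H0 - decay * k t * (norm (x - Y))\<^sup>2"
    by (rule field_le_epsilon)
  define b where "b = norm (x - Y)"
  have kpos: "k t > 0" unfolding k_def by (rule weight_pos[OF \<epsilon>])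
  have "norm P = 2 * k t * b" using kpos unfolding P_def b_def by simp
  then have 1: "H x t (w x t) P - H0 \<le> C1 * (\<beta> + 2 * k t * b) * b + K3 * (k t * b\<^sup>2)"
    using H1(3)[OF tT, of x "w x t" P Y] H3(2)[OF tT, of Y "w x t" P "u Y t"] wxt kpos
    unfolding H0_def b_def by (simp add: abs_le_iff)
  \<comment> \<open>Completing the square here is the source of the error
    \<open>C1 * \<beta> * \<epsilon> * exp (decay * t)\<close>.\<close>
  have "b - k t * b\<^sup>2 / 2 \<le> 1 / (2 * k t)"
  proof -
    have "0 \<le> (1 - k t * b)\<^sup>2 / (2 * k t)" using kpos by simp
    also have "\<dots> = 1 / (2 * k t) - (b - k t * b\<^sup>2 / 2)"
      using kpos by (simp add: field_simps power2_eq_square)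
    finally show ?thesis by simp
  qed
  also have "1 / (2 * k t) = \<epsilon> * exp (decay * t)"
    using \<epsilon> unfolding k_def weight_def by (simp add: exp_minus field_simps)
  finally have "(C1 * \<beta>) * (b - k t * b\<^sup>2 / 2) \<le> (C1 * \<beta>) * (\<epsilon> * exp (decay * t))"
    using H1 by (intro mult_left_mono) auto
  \<comment> \<open>The three summands of \<open>decay\<close> act separately: \<open>K3\<close>
    cancels (H3), \<open>2 * C1\<close> cancels the gradient part of (H1), and
    \<open>C1 * \<beta> / 2\<close> supplies the negative square bounded just before.\<close>
  moreover have "C1 * (\<beta> + 2 * k t * b) * b + K3 * (k t * b\<^sup>2) - decay * k t * b\<^sup>2 = (C1 * \<beta>) * (b - k t * b\<^sup>2 / 2)"
    unfolding decay_def by (simp add: algebra_simps power2_eq_square)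
  moreover have "H x t (w x t) P \<ge> H x t (w x t) p + q \<bullet> P - q \<bullet> p"
    using q[of P] by (simp add: inner_diff_right)
  ultimately have "Dt (x, t) + (H x t (w x t) p - C1 * \<beta> * \<epsilon> * exp (decay * t)) \<le> 0"
    using key' 1 unfolding b_def[symmetric] by (simp add: mult.assoc)
  then show "Dt (x, t) + (H x t (inf_conv \<epsilon> a R x t) (Dx (x, t)) - C1 * \<beta> * \<epsilon> * exp (decay * t)) \<le> 0"
    unfolding w_def p_def .
qed

end

subsection \<open>The gap between the solution and its inf-convolution\<close>

text \<open>If \<open>f\<close> dropped by less than \<theta> h, adding a smoothed cone of slope
  less than \<theta> would produce an interior minimum, and hence a subgradient that is too
  short.\<close>

lemma subdiff_bound_imp_decrease:
  fixes f :: "'a::euclidean_space \<Rightarrow> real"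
  assumes f: "continuous_on UNIV f" and \<theta>: "\<theta> > 0" and h: "h > 0"
    and U: "\<And>z p. z \<in> ball x h \<Longrightarrow> p \<in> subdiff f z \<Longrightarrow> norm p \<ge> \<theta>"
  obtains y where "y \<in> cball x h" "f y \<le> f x - \<theta> * h"
proof -
  have "continuous_on (cball x h) f" using f continuous_on_subset by blast
  then obtain y where y: "y \<in> cball x h" "\<And>z. z \<in> cball x h \<Longrightarrow> f y \<le> f z"
    using continuous_attains_inf[of "cball x h" f] h by auto
  have "f y \<le> f x - \<theta> * h"
  proof (rule ccontr)
    assume neg: "\<not> ?thesis"
    define b where "b = (f x - f y) / h"
    have b: "b \<ge> 0" "b < \<theta>" using y(2)[of x] h neg unfolding b_def
      by (auto simp: pos_divide_less_eq)
    define \<theta>' where "\<theta>' = (b + \<theta>) / 2"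
    have \<theta>': "b < \<theta>'" "\<theta>' < \<theta>" "\<theta>' > 0" using b unfolding \<theta>'_def by auto
    have fxy: "f x - f y = b * h" using h unfolding b_def by simp
    \<comment> \<open>The smoothing raises the value at the centre by only half of the margin
      \<open>(\<theta>' - b) * h\<close>, so minima on the sphere stay excluded.\<close>
    define \<delta> where "\<delta> = (\<theta>' - b) * h / (2 * \<theta>')"
    have \<delta>: "\<delta> > 0" "\<theta>' * \<delta> = (\<theta>' - b) * h / 2" using \<theta>' h unfolding \<delta>_def by auto
    have \<delta>2: "\<theta>' * \<delta> < (\<theta>' - b) * h" unfolding \<delta>(2) using \<theta>' h by simp
    define N where "N z = sqrt ((norm (z - x))\<^sup>2 + \<delta>\<^sup>2)" for z
    have N_pos: "N z > 0" for z unfolding N_def using \<delta> by (simp add: add_nonneg_pos)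
    have N_ge: "norm (z - x) \<le> N z" for z unfolding N_def by (simp add: real_le_rsqrt)
    have "continuous_on (cball x h) (\<lambda>z. f z + \<theta>' * N z)"
      unfolding N_def using \<open>continuous_on (cball x h) f\<close> by (intro continuous_intros)
    then obtain z where z: "z \<in> cball x h" "\<And>v. v \<in> cball x h \<Longrightarrow> f z + \<theta>' * N z \<le> f v + \<theta>' * N v"
      using continuous_attains_inf[of "cball x h" "\<lambda>z. f z + \<theta>' * N z"] h by auto
    have "norm (z - x) < h"
    proof (rule ccontr)
      assume "\<not> norm (z - x) < h"
      then have "\<theta>' * h \<le> \<theta>' * N z" using N_ge[of z] \<theta>' by (intro mult_left_mono) auto
      moreover have "f z + \<theta>' * N z \<le> f x + \<theta>' * \<delta>" using z(2)[of x] h \<delta> by (simp add: N_def)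
      moreover have "f y \<le> f z" using y z by blast
      ultimately show False using fxy \<delta>2 by (simp add: algebra_simps)
    qed
    then have zb: "z \<in> ball x h" by (simp add: dist_norm norm_minus_commute)
    define \<psi> where "\<psi> v = - \<theta>' * N v" for v
    define G where "G v = (- \<theta>' / N v) *\<^sub>R (v - x)" for v
    have "C1_x UNIV \<psi> G"
    proof -
      have "(\<psi> has_derivative (\<lambda>h. G v \<bullet> h)) (at v)" for v
      proof -
        have "((\<lambda>v. (v - x) \<bullet> (v - x) + \<delta>\<^sup>2) has_derivative (\<lambda>h. (v - x) \<bullet> (h - 0) + (h - 0) \<bullet> (v - x) + 0)) (at v)"
          by (intro derivative_intros)
        then have "((\<lambda>v. (norm (v - x))\<^sup>2 + \<delta>\<^sup>2) has_derivative (\<lambda>h. 2 * ((v - x) \<bullet> h))) (at v)"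
          unfolding power2_norm_eq_inner by (simp add: inner_commute)
        moreover have "(norm (v - x))\<^sup>2 + \<delta>\<^sup>2 > 0" using \<delta> by (simp add: add_nonneg_pos)
        ultimately have "((\<lambda>v. sqrt ((norm (v - x))\<^sup>2 + \<delta>\<^sup>2)) has_derivative
            (\<lambda>h. (2 * ((v - x) \<bullet> h)) * (inverse (N v) / 2))) (at v)"
          using has_derivative_real_sqrt unfolding N_def by (force simp: field_simps)
        then have "(N has_derivative (\<lambda>h. (2 * ((v - x) \<bullet> h)) * (inverse (N v) / 2))) (at v)"
          unfolding N_def[abs_def] .
        from has_derivative_mult_right[OF this, of "- \<theta>'"]
        have "(\<psi> has_derivative (\<lambda>h. - \<theta>' * (2 * ((v - x) \<bullet> h) * (inverse (N v) / 2)))) (at v)"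
          unfolding \<psi>_def[abs_def] .
        moreover have "- \<theta>' * (2 * ((v - x) \<bullet> h) * (inverse (N v) / 2)) = G v \<bullet> h" for h
          unfolding G_def inner_scaleR_left by (simp add: inverse_eq_divide)
        ultimately show ?thesis by simp
      qed
      moreover have "continuous_on UNIV N" unfolding N_def by (intro continuous_intros)
      then have "continuous_on UNIV G"
        unfolding G_def using N_pos by (intro continuous_intros) (auto simp: less_imp_neq[symmetric])
      ultimately show ?thesis unfolding C1_x_def by auto
    qed
    moreover have "\<forall>\<^sub>F v in nhds z. f v - \<psi> v \<ge> f z - \<psi> z"
      unfolding eventually_nhds using z zb unfolding \<psi>_def by (intro exI[of _ "ball x h"]) auto
    ultimately have "G z \<in> subdiff f z" unfolding subdiff_def by blast
    from U[OF zb this] have "\<theta> \<le> \<theta>' * (norm (z - x) / N z)"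
      using \<theta>' N_pos[of z] unfolding G_def by simp
    also have "\<dots> \<le> \<theta>' * 1"
      using N_ge[of z] N_pos[of z] \<theta>' by (intro mult_left_mono) auto
    finally show False using \<theta>' by simp
  qed
  then show thesis using that y by blast
qed

text \<open>The strict cone condition leaves room for a later tip and a larger speed; the latter is
  then positive, so the cone has positive radius before its tip even if
  \<open>A = B = 0\<close>.\<close>

lemma Rfun_less_perturb:
  assumes "A \<ge> 0" "B \<ge> 0" "t < T" and lt: "Rfun A B a t < c"
  obtains B' \<tau> where "B < B'" "t < \<tau>" "\<tau> < T" "Rfun A B' a \<tau> < c"
proof -
  have "continuous (at_right B) (\<lambda>B. Rfun A B a t)"
    unfolding Rfun_def by (cases "A > 0") (auto intro!: continuous_intros)
  then have "\<forall>\<^sub>F B' in at_right B. Rfun A B' a t < c"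
    using order_tendstoD(2)[of _ "Rfun A B a t"] lt unfolding continuous_within by blast
  then obtain B' where B': "B' > B" "Rfun A B' a t < c"
    using eventually_at_right_less[of B] by (metis (mono_tags, lifting) eventually_conj eventually_happens trivial_limit_at_right_real)
  have "continuous (at_right t) (Rfun A B' a)"
    using DERIV_isCont[OF Rfun_has_derivative[OF assms(1)]] by (rule continuous_at_imp_continuous_at_within)
  then have "\<forall>\<^sub>F \<tau> in at_right t. Rfun A B' a \<tau> < c"
    using order_tendstoD(2)[of _ "Rfun A B' a t"] B'(2) unfolding continuous_within by blast
  moreover have "\<forall>\<^sub>F \<tau> in at_right t. \<tau> \<in> {t<..<T}" using eventually_at_right_field assms(3) by auto
  ultimately have "\<forall>\<^sub>F \<tau> in at_right t. Rfun A B' a \<tau> < c \<and> \<tau> \<in> {t<..<T}" by (rule eventually_conj)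
  then obtain \<tau> where "Rfun A B' a \<tau> < c" "\<tau> \<in> {t<..<T}"
    using eventually_happens[of _ "at_right t"] by auto
  then show thesis using that B' by auto
qed

context hamilton_jacobi
begin

text \<open>The gap is normalised by \<open>4 * weight \<epsilon> t * gap \<theta> \<epsilon> t = slope \<theta> t\<close>, since the minimum of
  \<open>weight \<epsilon> t * d^2 - |p| * d\<close> over \<open>d\<close> is \<open>- |p|^2 / (4 * weight \<epsilon> t)\<close>.\<close>

definition slope :: "real \<Rightarrow> real \<Rightarrow> real" where
  "slope \<theta> t = \<theta>\<^sup>2 * exp (- (decay + K3) * t) - 2 * C1 * \<beta> * t"

definition gap :: "real \<Rightarrow> real \<Rightarrow> real \<Rightarrow> real" where
  "gap \<theta> \<epsilon> t = \<epsilon> / 2 * (exp (decay * t) * slope \<theta> t)"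

lemma C1_beta_nonneg: "C1 * \<beta> \<ge> 0" "0 \<le> \<beta>" "\<beta> \<le> 1"
  using H1(1,2) by auto

lemma slope_antimono: "s \<le> t \<Longrightarrow> slope \<theta> t \<le> slope \<theta> s"
  unfolding slope_def using C1_beta_nonneg(1) decay_nonneg H3(1)
  by (intro diff_mono mult_left_mono) (auto simp: mult_left_mono_neg mult_left_mono)

text \<open>The inequality is the budget of the comparison: \<open>K3 * gap\<close> pays for (H3),
  and the last term for the error in the equation of the inf-convolution. The linear term of
  \<open>slope\<close> provides exactly the latter; the surplus is \<open>(decay + K3) * C1 *
  \<beta> * t * \<epsilon> * exp (decay * t)\<close>.\<close>

lemma gap_has_derivative:
  obtains g' where "\<And>t. (gap \<theta> \<epsilon> has_real_derivative g' t) (at t)" "continuous_on UNIV g'"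
    "\<And>t. \<epsilon> \<ge> 0 \<Longrightarrow> t \<ge> 0 \<Longrightarrow> g' t \<le> - K3 * gap \<theta> \<epsilon> t - C1 * \<beta> * \<epsilon> * exp (decay * t)"
proof
  let ?c = "decay + K3"
  let ?g' = "\<lambda>t. \<epsilon> / 2 * (decay * exp (decay * t) * slope \<theta> t
      + exp (decay * t) * (- ?c * (\<theta>\<^sup>2 * exp (- ?c * t)) - 2 * C1 * \<beta>))"
  show "(gap \<theta> \<epsilon> has_real_derivative ?g' t) (at t)" for t
    unfolding gap_def[abs_def] slope_def by (auto intro!: derivative_eq_intros simp: algebra_simps)
  show "continuous_on UNIV ?g'" unfolding slope_def by (intro continuous_intros)
  show "?g' t \<le> - K3 * gap \<theta> \<epsilon> t - C1 * \<beta> * \<epsilon> * exp (decay * t)" if "\<epsilon> \<ge> 0" "t \<ge> 0" for t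
  proof -
    have "- K3 * gap \<theta> \<epsilon> t - C1 * \<beta> * \<epsilon> * exp (decay * t) - ?g' t
        = \<epsilon> / 2 * exp (decay * t) * (?c * (2 * (C1 * \<beta>) * t))"
      unfolding gap_def slope_def by (simp add: algebra_simps add_divide_distrib diff_divide_distrib)
    also have "\<dots> \<ge> 0" using that C1_beta_nonneg H1(1) decay_nonneg H3(1)
      by (intro mult_nonneg_nonneg) auto
    finally show ?thesis by simp
  qed
qed

lemma inf_conv_gap:
  assumes U: "\<theta> > 0" "\<And>x p. x \<in> ball x0 r \<Longrightarrow> p \<in> subdiff u0 x \<Longrightarrow> norm p \<ge> \<theta>"
    and \<tau>: "0 < t1" "t1 < \<tau>" "\<tau> < T" and slope: "slope \<theta> \<tau> \<ge> 0"
    and B: "B \<ge> B2" "B > 0" and cone: "Rfun A2 B a \<tau> + dist a x0 + \<epsilon> * \<theta> < r"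
    and R: "R = Rfun A2 B a \<tau> + 3" and D: "D \<ge> 0"
    and lip: "\<And>x y t. x \<in> cball a R \<Longrightarrow> y \<in> cball a R \<Longrightarrow> t \<in> {0..\<tau>} \<Longrightarrow> \<bar>u x t - u y t\<bar> \<le> D * norm (x - y)"
    and \<epsilon>: "\<epsilon> > 0" "\<epsilon> * \<theta> \<le> 3" "2 * \<epsilon> * D * exp (decay * \<tau>) < 1"
  shows "inf_conv \<epsilon> a R a t1 \<le> u a t1 - gap \<theta> \<epsilon> t1"
proof (rule ccontr)
  assume neg: "\<not> ?thesis"
  define w where "w = inf_conv \<epsilon> a R"
  define \<rho> where "\<rho> t = Rfun A2 B a (\<tau> - t)" for t
  have \<rho>_mono: "\<rho> t \<le> \<rho> s" if "s \<le> t" for s t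
    unfolding \<rho>_def using that B by (intro Rfun_mono H2(1)) auto
  have \<rho>\<tau>: "\<rho> \<tau> = 0" unfolding \<rho>_def by simp
  have \<rho>0: "\<rho> 0 \<ge> 0" using \<rho>_mono[of 0 \<tau>] \<rho>\<tau> \<tau> by simp
  have R_eq: "R = \<rho> 0 + 3" unfolding R \<rho>_def by simp
  define R1 where "R1 = \<rho> 0 + 1"
  have R1_sub: "x \<in> cball a R1 \<Longrightarrow> x \<in> cball a R" for x unfolding R1_def R_eq by simp
  have w_le_u: "w x t \<le> u x t" if "x \<in> cball a R" "t \<in> {0..\<tau>}" for x t
  proof -
    have "t \<in> {0..<T}" using that \<tau> by auto
    then show ?thesis
      using inf_conv_attained[of R t a \<epsilon> x] that \<rho>0 unfolding w_def R_eq by (metis add_nonneg_nonneg diff_self norm_zero zero_power2 mult_zero_right add.right_neutral zero_le_numeral)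
  qed
  define K where "K = K3 + 1"
  have K: "K > 0" using H3(1) unfolding K_def by simp
  define m0 where "m0 = (w a t1 - u a t1 + gap \<theta> \<epsilon> t1) / exp (K * t1)"
  have m0: "m0 > 0" using neg unfolding m0_def w_def by simp
  \<comment> \<open>All smallness conditions on \<alpha> are collected here:
    \<open>2 * \<alpha> * D < 1\<close> keeps \<open>y\<close> in the ball,
    \<open>\<alpha> * D\<^sup>2 / 2 < m0\<close> excludes time 0, and the first summand bounds the
    final doubling error by \<open>m0\<close>.\<close>
  define E0 where "E0 = (K3 * D + C1 * (1 + 2 * D)) * (2 * D) + D\<^sup>2 + 2 * D + 1"
  have E0_parts: "(K3 * D + C1 * (1 + 2 * D)) * (2 * D) \<ge> 0" "D\<^sup>2 \<ge> 0" using D H1(1) H3(1) by auto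
  have E0: "E0 > 0" using E0_parts D unfolding E0_def by linarith
  define \<alpha> where "\<alpha> = min m0 1 / (2 * E0)"
  have \<alpha>: "\<alpha> > 0" using m0 E0 unfolding \<alpha>_def by auto
  have \<alpha>E0: "\<alpha> * E0 < m0" "\<alpha> * E0 < 1" using E0 m0 unfolding \<alpha>_def by auto
  have part: "\<alpha> * v \<le> \<alpha> * E0" if "v \<le> E0" for v using \<alpha> that by simp
  have \<alpha>1: "2 * \<alpha> * D < 1" using part[of "2 * D"] E0_parts \<alpha>E0 unfolding E0_def by (simp add: mult_ac)
  have \<alpha>2: "\<alpha> * D\<^sup>2 / 2 < m0"
  proof -
    have "\<alpha> * D\<^sup>2 \<le> \<alpha> * E0" using E0_parts D unfolding E0_def by (intro part[unfolded E0_def]) linarith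
    moreover have "\<alpha> * D\<^sup>2 \<ge> 0" using \<alpha> by simp
    ultimately show ?thesis using \<alpha>E0 by linarith
  qed
  have \<alpha>3: "(K3 * D + C1 * (1 + 2 * D)) * (2 * \<alpha> * D) < m0"
  proof -
    have "\<alpha> * ((K3 * D + C1 * (1 + 2 * D)) * (2 * D)) \<le> \<alpha> * E0"
      using E0_parts D unfolding E0_def by (intro part[unfolded E0_def]) linarith
    then show ?thesis using \<alpha>E0 by (simp add: mult_ac)
  qed
  have cu: "continuous_on (cball a R1 \<times> {0..\<tau>}) (\<lambda>(x, t). u x t)"
    by (rule continuous_on_subset[OF u_cont]) (use \<tau> in auto)
  have cw: "continuous_on (cball a R1 \<times> {0..\<tau>}) (\<lambda>(x, t). w x t)"
    unfolding w_def using \<rho>0 \<tau> \<epsilon> R_eq by (intro inf_conv_continuous) auto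
  have cH: "continuous_on (UNIV \<times> {0..\<tau>} \<times> UNIV \<times> UNIV) (\<lambda>(x, t, v, p). H x t v p)"
    by (rule continuous_on_subset[OF H_cont]) (use \<tau> in auto)
  let ?F = "\<lambda>x t v p. H x t v p - C1 * \<beta> * \<epsilon> * exp (decay * t)"
  have cF: "continuous_on (UNIV \<times> {0..\<tau>} \<times> UNIV \<times> UNIV) (\<lambda>(x, t, v, p). ?F x t v p)"
    using cH unfolding case_prod_unfold by (intro continuous_intros)
  have "compact ((\<lambda>(x, t). u x t) ` (cball a R1 \<times> {0..\<tau>}))"
    by (intro compact_continuous_image cu compact_Times compact_cball compact_Icc)
  then obtain M where M: "\<And>x t. x \<in> cball a R1 \<Longrightarrow> t \<in> {0..\<tau>} \<Longrightarrow> \<bar>u x t\<bar> \<le> M"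
    by (force dest!: compact_imp_bounded simp: bounded_iff)
  have M0: "M \<ge> 0" using M[of a 0] \<rho>0 \<tau> unfolding R1_def by auto
  obtain g' where g': "\<And>t. (gap \<theta> \<epsilon> has_real_derivative g' t) (at t)" "continuous_on UNIV g'"
    "\<And>t. \<epsilon> \<ge> 0 \<Longrightarrow> t \<ge> 0 \<Longrightarrow> g' t \<le> - K3 * gap \<theta> \<epsilon> t - C1 * \<beta> * \<epsilon> * exp (decay * t)"
    by (rule gap_has_derivative[of \<theta> \<epsilon>]) blast
  define MG where "MG = \<epsilon> / 2 * (exp (decay * \<tau>) * \<theta>\<^sup>2)"
  have gap0: "gap \<theta> \<epsilon> t \<ge> 0" "gap \<theta> \<epsilon> t \<le> MG" if "t \<in> {0..\<tau>}" for t
  proof -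
    have sl: "slope \<theta> t \<ge> 0" "slope \<theta> t \<le> \<theta>\<^sup>2"
      using slope slope_antimono[of t \<tau> \<theta>] slope_antimono[of 0 t \<theta>] that by (auto simp: slope_def)
    then show "gap \<theta> \<epsilon> t \<ge> 0" unfolding gap_def using \<epsilon> by simp
    have "exp (decay * t) \<le> exp (decay * \<tau>)" using that decay_nonneg by (simp add: mult_left_mono)
    then show "gap \<theta> \<epsilon> t \<le> MG"
      unfolding gap_def MG_def using sl \<epsilon> by (intro mult_left_mono mult_mono) auto
  qed
  have MG0: "MG \<ge> 0" unfolding MG_def using \<epsilon> by simp
  \<comment> \<open>With this value the barrier vanishes at \<open>(a, t1)\<close>, the point where
    the inequality is assumed to fail.\<close>
  define c where "c = (\<rho> t1)\<^sup>2"
  have "B * (\<tau> - t1) \<le> \<rho> t1" unfolding \<rho>_def using B \<tau> by (intro Rfun_ge H2(1)) auto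
  moreover have "B * (\<tau> - t1) > 0" using B \<tau> by simp
  ultimately have c: "c > 0" unfolding c_def by simp
  obtain P :: "'a \<times> real \<Rightarrow> real" and DP Pt where P: "C1_xt UNIV P DP Pt" "\<And>z. P z \<ge> 0"
    "\<And>x t. (norm (x - a))\<^sup>2 + c \<le> (\<rho> t)\<^sup>2 \<Longrightarrow> P (x, t) = 0"
    "\<And>x t. t \<le> \<tau> \<Longrightarrow> norm (x - a) \<ge> \<rho> t \<Longrightarrow> P (x, t) \<ge> 2 * M + MG + 1"
    "\<And>x t. t \<le> \<tau> \<Longrightarrow> norm (x - a) < \<rho> t \<Longrightarrow> (A2 * norm x + B) * norm (DP (x, t)) \<le> Pt (x, t)"
    using cone_barrier[of A2 B c "2 * M + MG + 1" a \<tau>] H2(1) B M0 MG0 c unfolding \<rho>_def by auto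
  have P1: "P (a, t1) = 0" by (rule P(3)) (simp add: c_def)
  have dE: "((\<lambda>t. exp (K * t)) has_real_derivative K * exp (K * t)) (at t)" for t
    by (auto intro!: derivative_eq_intros)
  have dG: "((\<lambda>t. - gap \<theta> \<epsilon> t) has_real_derivative - g' t) (at t)" for t
    by (intro DERIV_minus g')
  have cG: "continuous_on UNIV (\<lambda>t. - g' t)" by (intro continuous_intros g')
  have cE: "continuous_on UNIV (\<lambda>t. K * exp (K * t))" by (intro continuous_intros)
  have Q: "C1_xt UNIV (\<lambda>z. - gap \<theta> \<epsilon> (snd z) + exp (K * snd z) * P z) (\<lambda>z. exp (K * snd z) *\<^sub>R DP z)
      (\<lambda>z. - g' (snd z) + (exp (K * snd z) * Pt z + P z * (K * exp (K * snd z))))"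
    using C1_xt_add[OF C1_xt_time[OF dG cG] C1_xt_mult[OF C1_xt_time[OF dE cE] P(1)]] by simp
  have d\<kappa>: "((\<lambda>t. 1 / (2 * \<alpha>)) has_real_derivative 0) (at t)" for t by simp
  \<comment> \<open>The radii \<open>\<rho> 0 + 1\<close>, \<open>\<rho> 0 + 2\<close> and
    \<open>\<rho> 0 + 3\<close> are those of the doubling, of the subsolution property and of the
    minimization; the last step of 1 accommodates the displacement of minimizers.\<close>
  have sub: "visc_sub_at ?F w x t" if "x \<in> ball a R1" "0 < t" "t < \<tau>" for x t
    unfolding w_def
    by (rule inf_conv_visc_sub[OF \<epsilon>(1) \<tau>(3) D lip, where R' = "\<rho> 0 + 2"])
      (use that \<epsilon>(3) in \<open>auto simp: R1_def R_eq\<close>)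
  have init: "w x 0 \<le> u x 0 - gap \<theta> \<epsilon> 0" if x: "x \<in> ball a (\<rho> 0)" for x
  proof -
    \<comment> \<open>The distance \<open>\<epsilon> * \<theta>\<close> maximizes the drop \<theta>
      h minus the penalty h^2 / (2 \<epsilon>), with maximum
      \<open>\<epsilon> * \<theta>\<^sup>2 / 2\<close>, the gap at time 0.\<close>
    have h: "\<epsilon> * \<theta> > 0" using \<epsilon> U by simp
    have "ball x (\<epsilon> * \<theta>) \<subseteq> ball x0 r"
    proof
      fix z assume "z \<in> ball x (\<epsilon> * \<theta>)"
      then show "z \<in> ball x0 r"
        using x cone dist_triangle[of x0 z x] dist_triangle[of x0 x a] unfolding \<rho>_def
        by (simp add: dist_commute)
    qed
    then obtain y where y: "y \<in> cball x (\<epsilon> * \<theta>)" "u0 y \<le> u0 x - \<theta> * (\<epsilon> * \<theta>)"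
      using subdiff_bound_imp_decrease[OF lipschitz_on_continuous_on[OF u0_lip] U(1) h, of x] U(2) by blast
    have yR: "y \<in> cball a R"
      using y(1) x \<epsilon>(2) dist_triangle[of a y x] unfolding R_eq by simp
    have 0: "0 \<in> {0..<T}" using \<tau> by simp
    have "w x 0 \<le> u y 0 + weight \<epsilon> 0 * (norm (x - y))\<^sup>2"
      using inf_conv_attained[OF _ 0, of R a \<epsilon> x] yR \<rho>0 R_eq unfolding w_def by (metis add_nonneg_nonneg zero_le_numeral)
    also have "weight \<epsilon> 0 * (norm (x - y))\<^sup>2 \<le> weight \<epsilon> 0 * (\<epsilon> * \<theta>)\<^sup>2"
      using y(1) weight_pos[OF \<epsilon>(1), of 0] by (intro mult_left_mono power_mono) (auto simp: dist_norm)
    also have "u y 0 + weight \<epsilon> 0 * (\<epsilon> * \<theta>)\<^sup>2 \<le> u x 0 - gap \<theta> \<epsilon> 0"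
      using y(2) \<epsilon>(1) unfolding u_init gap_def slope_def weight_def
      by (simp add: field_simps power2_eq_square)
    finally show ?thesis by simp
  qed
  have facts: "x \<in> ball a R1 \<and> y \<in> ball a R1 \<and> 0 < t \<and> t < \<tau> \<and> norm (x - a) < \<rho> t
      \<and> norm (x - y) \<le> 2 * \<alpha> * D \<and> (norm (x - y))\<^sup>2 / (2 * \<alpha>) \<le> D * norm (x - y)"
    if m: "m \<ge> m0" and box: "x \<in> cball a R1" "y \<in> cball a R1" "t \<in> {0..\<tau>}"
      and eq: "w x t - u y t = - gap \<theta> \<epsilon> (snd (x, t)) + exp (K * snd (x, t)) * P (x, t)
        + 1 / (2 * \<alpha>) * (norm (x - y))\<^sup>2 + m * exp (K * t)"
      and diag: "w x t - u x t \<le> - gap \<theta> \<epsilon> (snd (x, t)) + exp (K * snd (x, t)) * P (x, t) + m * exp (K * t)"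
    for m x y t
  proof -
    let ?d = "norm (x - y)"
    have eq': "w x t - u y t = - gap \<theta> \<epsilon> t + exp (K * t) * P (x, t) + ?d\<^sup>2 / (2 * \<alpha>) + m * exp (K * t)"
      using eq by simp
    have E: "exp (K * t) \<ge> 1" using box K by auto
    have lipxy: "\<bar>u x t - u y t\<bar> \<le> D * ?d" using lip R1_sub box by blast
    have dd: "?d\<^sup>2 / (2 * \<alpha>) \<le> D * ?d" using eq' diag lipxy by simp
    have d: "?d \<le> 2 * \<alpha> * D"
    proof (cases "?d = 0")
      case False
      then have "?d > 0" by simp
      then show ?thesis using dd \<alpha> by (simp add: power2_eq_square field_simps)
    qed (use \<alpha> D in simp)
    have dnn: "?d\<^sup>2 / (2 * \<alpha>) \<ge> 0" using \<alpha> by simp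
    have mE: "m * exp (K * t) \<ge> m" using E m m0 by simp
    have "P (x, t) \<le> exp (K * t) * P (x, t)" using mult_right_mono[OF E P(2)] by simp
    moreover have "w x t - u y t \<le> 2 * M"
      using w_le_u[OF R1_sub[OF box(1)] box(3)] M[OF box(1,3)] M[OF box(2,3)] by linarith
    moreover have "gap \<theta> \<epsilon> t \<le> MG" by (rule gap0(2)[OF box(3)])
    ultimately have "P (x, t) < 2 * M + MG + 1" using eq' dnn mE m m0 by linarith
    then have lt: "norm (x - a) < \<rho> t" using P(4)[of t x] box by force
    have "\<rho> t \<le> \<rho> 0" using \<rho>_mono box by auto
    then have x: "x \<in> ball a (\<rho> 0)" using lt by (simp add: dist_norm norm_minus_commute)
    then have y: "y \<in> ball a R1"
      using d \<alpha>1 dist_triangle[of a y x] unfolding R1_def by (simp add: dist_norm)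
    have "t \<noteq> \<tau>" using lt \<rho>\<tau> by auto
    moreover have "t \<noteq> 0"
    proof
      assume t: "t = 0"
      have "D * ?d \<le> \<alpha> * D\<^sup>2 / 2 + ?d\<^sup>2 / (2 * \<alpha>)"
      proof -
        have "0 \<le> (?d - \<alpha> * D)\<^sup>2 / (2 * \<alpha>)" using \<alpha> by simp
        also have "\<dots> = \<alpha> * D\<^sup>2 / 2 + ?d\<^sup>2 / (2 * \<alpha>) - D * ?d"
          using \<alpha> by (simp add: field_simps power2_eq_square)
        finally show ?thesis by simp
      qed
      moreover have "exp (K * t) * P (x, t) \<ge> 0" using P(2) by simp
      ultimately show False using init[OF x] eq' lipxy mE m \<alpha>2 t by simp
    qed
    ultimately show ?thesis using x y lt box d dd unfolding R1_def by auto
  qed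
  have a1: "a \<in> cball a R1" "t1 \<in> {0..\<tau>}" using \<rho>0 \<tau> unfolding R1_def by auto
  have viol: "w a t1 - u a t1 \<ge> - gap \<theta> \<epsilon> (snd (a, t1)) + exp (K * snd (a, t1)) * P (a, t1)
      + 1 / (2 * \<alpha>) * (norm (a - a))\<^sup>2 + m0 * exp (K * t1)"
    unfolding P1 m0_def by simp
  have super: "visc_super_at H u x t" if "x \<in> ball a R1" "0 < t" "t < \<tau>" for x t
    using viscosity_solution_imp_sub_super(2)[OF sol] that \<tau> by auto
  obtain m x y t where c1: "m \<ge> m0" "x \<in> ball a R1" "y \<in> ball a R1" "0 < t" "t < \<tau>"
    "w x t - u y t = - gap \<theta> \<epsilon> (snd (x, t)) + exp (K * snd (x, t)) * P (x, t)
        + 1 / (2 * \<alpha>) * (norm (x - y))\<^sup>2 + m * exp (K * t)"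
    "w x t - u x t \<le> - gap \<theta> \<epsilon> (snd (x, t)) + exp (K * snd (x, t)) * P (x, t) + m * exp (K * t)"
    "- g' (snd (x, t)) + (exp (K * snd (x, t)) * Pt (x, t) + P (x, t) * (K * exp (K * snd (x, t))))
       + K * m * exp (K * t) + 0 * (norm (x - y))\<^sup>2
       + ?F x t (w x t) (exp (K * snd (x, t)) *\<^sub>R DP (x, t) + (2 * (1 / (2 * \<alpha>))) *\<^sub>R (x - y))
       - H y t (u y t) ((2 * (1 / (2 * \<alpha>))) *\<^sub>R (x - y)) \<le> 0"
    by (rule viscosity_contact_exponential[OF cw cu cF cH sub super Q d\<kappa> continuous_on_const _ a1(1) a1 viol])
      (use facts in blast)+
  define d where "d = norm (x - y)"
  define p where "p = (2 * (1 / (2 * \<alpha>))) *\<^sub>R (x - y)"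
  have F: "norm (x - a) < \<rho> t" "d \<le> 2 * \<alpha> * D" "d\<^sup>2 / (2 * \<alpha>) \<le> D * d"
    using facts[OF c1(1) _ _ _ c1(6,7)] c1 unfolding d_def by auto
  have d0: "d \<ge> 0" unfolding d_def by simp
  have m: "m > 0" using m0 c1 by simp
  have E: "exp (K * t) \<ge> 1" using c1 K by auto
  have p: "norm p \<le> 2 * D"
  proof -
    have "norm p = d / \<alpha>" unfolding p_def d_def using \<alpha> by simp
    then show ?thesis using F(2) \<alpha> by (simp add: pos_divide_le_eq mult_ac)
  qed
  \<comment> \<open>The sign of \<open>w x t - u y t\<close> is unknown, so the gap enters with a
    plus sign, and (H3) costs a full \<open>K3 * gap\<close>.\<close>
  have abs: "\<bar>w x t - u y t\<bar> \<le> gap \<theta> \<epsilon> t + exp (K * t) * P (x, t) + D * d + m * exp (K * t)"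
  proof -
    have "w x t - u y t = - gap \<theta> \<epsilon> t + exp (K * t) * P (x, t) + d\<^sup>2 / (2 * \<alpha>) + m * exp (K * t)"
      using c1(6) unfolding d_def by simp
    moreover have "exp (K * t) * P (x, t) \<ge> 0" "d\<^sup>2 / (2 * \<alpha>) \<ge> 0" "m * exp (K * t) \<ge> 0" "gap \<theta> \<epsilon> t \<ge> 0" "D * d \<ge> 0"
      using P(2) \<alpha> m gap0(1)[of t] c1 D d0 by auto
    ultimately show ?thesis using F(3) by linarith
  qed
  have "H x t (w x t) (exp (K * t) *\<^sub>R DP (x, t) + p) - H y t (u y t) p
    \<ge> - (A2 * norm x + B) * norm (exp (K * t) *\<^sub>R DP (x, t)) - C1 * (\<beta> + norm p) * norm (x - y) - K3 * \<bar>w x t - u y t\<bar>"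
    using c1 \<tau> B by (intro H_diff_ge) auto
  moreover have "(A2 * norm x + B) * norm (exp (K * t) *\<^sub>R DP (x, t)) \<le> exp (K * t) * Pt (x, t)"
    using mult_left_mono[OF P(5)[of t x], of "exp (K * t)"] F c1 by (simp add: algebra_simps)
  moreover have "C1 * (\<beta> + norm p) * norm (x - y) \<le> C1 * (1 + 2 * D) * d"
    unfolding d_def using p C1_beta_nonneg H1(1) by (intro mult_right_mono mult_left_mono add_mono) auto
  moreover have "K3 * \<bar>w x t - u y t\<bar> \<le> K3 * gap \<theta> \<epsilon> t + K3 * (exp (K * t) * P (x, t)) + K3 * D * d + K3 * (m * exp (K * t))"
    using mult_left_mono[OF abs H3(1)] by (simp add: algebra_simps)
  moreover have "- g' t + exp (K * t) * Pt (x, t) + K * (exp (K * t) * P (x, t)) + K * (m * exp (K * t))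
       - C1 * \<beta> * \<epsilon> * exp (decay * t) + H x t (w x t) (exp (K * t) *\<^sub>R DP (x, t) + p) - H y t (u y t) p \<le> 0"
    using c1(8) unfolding p_def[symmetric] by (simp add: mult_ac)
  moreover have "g' t \<le> - K3 * gap \<theta> \<epsilon> t - C1 * \<beta> * \<epsilon> * exp (decay * t)"
    using g'(3)[of t] \<epsilon> c1 by simp
  moreover have "K * (exp (K * t) * P (x, t)) = K3 * (exp (K * t) * P (x, t)) + exp (K * t) * P (x, t)"
    "K * (m * exp (K * t)) = K3 * (m * exp (K * t)) + m * exp (K * t)"
    unfolding K_def by (simp_all add: algebra_simps)
  moreover have "exp (K * t) * P (x, t) \<ge> 0" using P(2) by simp
  moreover have "m * exp (K * t) \<ge> m" using E m by simp
  \<comment> \<open>The surplus 1 of \<open>K\<close> over \<open>K3\<close> leaves \<open>m\<close>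
    on the left, against errors of the order of |x - y|, which the choice of \<alpha> keeps below
    \<open>m0\<close>.\<close>
  ultimately have "m \<le> K3 * D * d + C1 * (1 + 2 * D) * d" by linarith
  also have "\<dots> = (K3 * D + C1 * (1 + 2 * D)) * d" by (simp add: algebra_simps)
  also have "\<dots> \<le> (K3 * D + C1 * (1 + 2 * D)) * (2 * \<alpha> * D)"
    using F(2) H1(1) H3(1) D by (intro mult_left_mono) auto
  also have "\<dots> < m0" by (rule \<alpha>3)
  finally show False using c1(1) by simp
qed


text \<open>For small \<epsilon> the minimizer of the inf-convolution at \<open>(x, t)\<close> lies
  where \<phi> touches \<open>u\<close> from below and is affine up to \<open>e * d\<close>. This
  caps the gap by (|p| + e) d - k d^2 with \<open>k = weight \<epsilon> t\<close>; multiplied by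
  \<open>4 * k\<close>, the gap becomes \<open>slope \<theta> t\<close>, which is free of
  \<epsilon>.\<close>

lemma subdiff_x_lower_bound:
  assumes U: "\<theta> > 0" "\<And>x p. x \<in> ball x0 r \<Longrightarrow> p \<in> subdiff u0 x \<Longrightarrow> norm p \<ge> \<theta>"
    and t: "0 < t" "t < t0" "t0 \<le> T" and slope_pos: "slope \<theta> t0 > 0"
    and cone: "Rfun A2 B2 x t + dist x x0 < r" and p: "p \<in> subdiff_x u x t"
  shows "sqrt (slope \<theta> t) \<le> norm p"
proof (rule field_le_epsilon)
  fix e :: real assume e: "e > 0"
  obtain \<phi> Dx Dt where \<phi>: "C1_xt UNIV \<phi> Dx Dt" "p = Dx (x, t)"
      "\<forall>\<^sub>F (y, s) in nhds (x, t). u y s - \<phi> (y, s) \<ge> u x t - \<phi> (x, t)"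
    using p unfolding subdiff_x_def subdiff_xt_def by blast
  obtain \<delta>1 where \<delta>1: "\<delta>1 > 0" "\<And>y s. dist (y, s) (x, t) < \<delta>1 \<Longrightarrow> u y s - \<phi> (y, s) \<ge> u x t - \<phi> (x, t)"
    using \<phi>(3) unfolding eventually_nhds_metric by (auto simp: case_prod_unfold)
  have "(\<phi> has_derivative (\<lambda>(h, s). Dx (x, t) \<bullet> h + Dt (x, t) * s)) (at (x, t))"
    using \<phi>(1) unfolding C1_xt_def by blast
  then obtain \<delta>2 where \<delta>2: "\<delta>2 > 0" "\<And>z. norm (z - (x, t)) < \<delta>2 \<Longrightarrow>
      norm (\<phi> z - \<phi> (x, t) - (\<lambda>(h, s). Dx (x, t) \<bullet> h + Dt (x, t) * s) (z - (x, t))) \<le> e * norm (z - (x, t))"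
    unfolding has_derivative_at_alt using e by blast
  have "Rfun A2 B2 x t < r - dist x x0" using cone by simp
  then obtain B \<tau> where B: "B2 < B" and \<tau>: "t < \<tau>" "\<tau> < t0" and Rfun: "Rfun A2 B x \<tau> < r - dist x x0"
    using Rfun_less_perturb[OF H2(1,2) t(2)] by blast
  have \<tau>T: "0 < \<tau>" "\<tau> < T" using t \<tau> by auto
  have B0: "B > 0" using B H2(2) by simp
  have slope\<tau>: "slope \<theta> \<tau> \<ge> 0" using slope_antimono[of \<tau> t0 \<theta>] slope_pos \<tau> by simp
  have slope_t: "slope \<theta> t \<ge> 0" using slope_antimono[of t \<tau> \<theta>] slope\<tau> \<tau> by simp
  define R where "R = Rfun A2 B x \<tau> + 3"
  have R: "R \<ge> 0" using Rfun_mono[OF H2(1), of B 0 \<tau> x] B0 \<tau>T unfolding R_def by simp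
  obtain D where D: "D \<ge> 0" "\<And>y z s. y \<in> cball x R \<Longrightarrow> z \<in> cball x R \<Longrightarrow> s \<in> {0..\<tau>} \<Longrightarrow>
      \<bar>u y s - u z s\<bar> \<le> D * norm (y - z)"
    using u_lipschitz_in_x[of \<tau> x R] \<tau>T by (metis less_imp_le)
  define c where "c = min (min (r - dist x x0 - Rfun A2 B x \<tau>) 1) (min \<delta>1 \<delta>2)"
  have c: "c > 0" "c \<le> r - dist x x0 - Rfun A2 B x \<tau>" "c \<le> 1" "c \<le> \<delta>1" "c \<le> \<delta>2"
    using Rfun \<delta>1(1) \<delta>2(1) unfolding c_def by auto
  \<comment> \<open>\<open>\<epsilon> * Z < c\<close> bounds both lengths at once: the initial drop
    distance \<open>\<epsilon> * \<theta>\<close> and the displacement of minimizers.\<close>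
  define Z where "Z = \<theta> + 2 * D * exp (decay * \<tau>)"
  have DE: "2 * D * exp (decay * \<tau>) \<ge> 0" using D(1) by simp
  have Z: "Z > 0" using U(1) DE unfolding Z_def by linarith
  define \<epsilon> where "\<epsilon> = c / (2 * Z)"
  have \<epsilon>: "\<epsilon> > 0" "\<epsilon> * Z < c" using c(1) Z unfolding \<epsilon>_def by auto
  have "\<epsilon> * \<theta> \<le> \<epsilon> * Z" "\<epsilon> * (2 * D * exp (decay * \<tau>)) \<le> \<epsilon> * Z"
    using \<epsilon>(1) U(1) DE unfolding Z_def by (auto intro!: mult_left_mono)
  then have \<epsilon>\<theta>: "\<epsilon> * \<theta> < c" and \<epsilon>D: "2 * \<epsilon> * D * exp (decay * \<tau>) < c"
    using \<epsilon>(2) by (auto simp: mult_ac)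
  define k where "k = weight \<epsilon> t"
  have k: "k > 0" unfolding k_def by (rule weight_pos[OF \<epsilon>(1)])
  have "inf_conv \<epsilon> x R x t \<le> u x t - gap \<theta> \<epsilon> t"
    by (rule inf_conv_gap[OF U t(1) \<tau>(1) \<tau>T(2) slope\<tau> _ B0 _ R_def D]) (use B \<epsilon> \<epsilon>\<theta> \<epsilon>D c in auto)
  moreover have tT: "t \<in> {0..<T}" using t by auto
  ultimately obtain y where y: "y \<in> cball x R" "u y t + k * (norm (x - y))\<^sup>2 \<le> u x t - gap \<theta> \<epsilon> t"
    using inf_conv_attained[OF R tT, of x \<epsilon> x] unfolding k_def by metis
  define d where "d = norm (x - y)"
  have "gap \<theta> \<epsilon> t \<ge> 0" unfolding gap_def using \<epsilon> slope_t by simp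
  then have "d \<le> 2 * \<epsilon> * D * exp (decay * \<tau>)"
    unfolding d_def using y t \<tau> R D
    by (intro inf_conv_minimizer_close[OF \<epsilon>(1), of t]) (auto simp: k_def)
  then have d: "d < \<delta>1" "d < \<delta>2" using \<epsilon>D c by auto
  have dist: "dist (y, t) (x, t) = d" "(y, t) - (x, t) = (y - x, 0)" "norm (y - x, 0::real) = d"
    unfolding d_def by (simp_all add: dist_Pair_Pair dist_norm norm_minus_commute norm_Pair)
  have "u y t - u x t \<ge> \<phi> (y, t) - \<phi> (x, t)" using \<delta>1(2)[of y t] d dist by simp
  moreover have "\<bar>\<phi> (y, t) - \<phi> (x, t) - p \<bullet> (y - x)\<bar> \<le> e * d"
    using \<delta>2(2)[of "(y, t)"] d unfolding dist \<phi>(2) by simp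
  moreover have "\<bar>p \<bullet> (y - x)\<bar> \<le> norm p * d"
    using Cauchy_Schwarz_ineq2[of p "y - x"] unfolding d_def by (simp add: norm_minus_commute)
  ultimately have gap_le: "gap \<theta> \<epsilon> t \<le> (norm p + e) * d - k * d\<^sup>2"
    using y(2) unfolding d_def[symmetric] by (simp add: algebra_simps)
  have "slope \<theta> t = 4 * k * gap \<theta> \<epsilon> t"
    using \<epsilon>(1) unfolding k_def weight_def gap_def by (simp add: exp_minus field_simps)
  also have "\<dots> \<le> 4 * k * ((norm p + e) * d - k * d\<^sup>2)"
    using gap_le k by (intro mult_left_mono) auto
  also have "\<dots> = (norm p + e)\<^sup>2 - (2 * k * d - (norm p + e))\<^sup>2"
    by (simp add: power2_eq_square algebra_simps)
  also have "\<dots> \<le> (norm p + e)\<^sup>2" by simp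
  finally show "sqrt (slope \<theta> t) \<le> norm p + e"
    using e by (intro real_le_lsqrt) auto
qed

end

theorem theorem1p3:
  fixes H :: "'a::euclidean_space \<Rightarrow> real \<Rightarrow> real \<Rightarrow> 'a \<Rightarrow> real"
    and u0 :: "'a \<Rightarrow> real" and u :: "'a \<Rightarrow> real \<Rightarrow> real"
    and T C1 \<beta> A2 B2 K3 r \<theta> :: real and x0 :: 'a
  assumes T: "T > 0"
    and H_cont: "continuous_on (UNIV \<times> {0..T} \<times> UNIV \<times> UNIV) (\<lambda>(x, t, v, p). H x t v p)"
    and u0_lip: "\<exists>L. L-lipschitz_on UNIV u0"
    and H1: "C1 \<ge> 0" "\<beta> \<in> {0, 1}"
      "\<And>x y t v p. t \<in> {0..T} \<Longrightarrow> \<bar>H x t v p - H y t v p\<bar> \<le> C1 * (\<beta> + norm p) * norm (x - y)"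
    and H2: "A2 \<ge> 0" "B2 \<ge> 0"
      "\<And>x t v p q. t \<in> {0..T} \<Longrightarrow> \<bar>H x t v p - H x t v q\<bar> \<le> (A2 * norm x + B2) * norm (p - q)"
    and H3: "K3 \<ge> 0"
      "\<And>x t v w p. t \<in> {0..T} \<Longrightarrow> \<bar>H x t v p - H x t w p\<bar> \<le> K3 * \<bar>v - w\<bar>"
    and H4: "\<And>x t v. t \<in> {0..T} \<Longrightarrow> convex_on UNIV (H x t v)"
    and r: "r > 0" and U: "\<theta> > 0" "\<And>x p. x \<in> ball x0 r \<Longrightarrow> p \<in> subdiff u0 x \<Longrightarrow> norm p \<ge> \<theta>"
    and sol: "viscosity_solution H u0 T u"
  shows "\<forall>t0 \<in> {0<..T}.
           \<theta>\<^sup>2 * exp (- ((\<beta> / 2 + 2) * C1 + 2 * K3) * t0) - 2 * C1 * \<beta> * t0 > 0 \<longrightarrow>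
           (\<forall>x t p. (x, t) \<in> Eset A2 B2 T x0 r \<and> t < t0 \<and> p \<in> subdiff_x u x t \<longrightarrow>
              norm p \<ge> sqrt (\<theta>\<^sup>2 * exp (- ((\<beta> / 2 + 2) * C1 + 2 * K3) * t) - 2 * C1 * \<beta> * t))"
proof -
  obtain L where "L-lipschitz_on UNIV u0" using u0_lip by blast
  then interpret hamilton_jacobi H u0 u T C1 \<beta> A2 B2 K3 L
    using H_cont H1 H2 H3 H4 sol by unfold_locales
  have "(\<beta> / 2 + 2) * C1 + 2 * K3 = decay + K3" unfolding decay_def by (simp add: algebra_simps)
  then have slope: "\<theta>\<^sup>2 * exp (- ((\<beta> / 2 + 2) * C1 + 2 * K3) * t) - 2 * C1 * \<beta> * t = slope \<theta> t" for t
    unfolding slope_def by simp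
  show ?thesis
    unfolding slope using subdiff_x_lower_bound[OF U] by (auto simp: Eset_def)
qed

end
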